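(* The three functions $$\biggl[\frac{\Gamma(x+1)}{\sqrt{2\pi}}\biggl(\frac{e}{x+1/2}\biggr)^{x+1/2}\biggr]^{x},\qquad \biggl[\frac{\sqrt{2\pi}}{\Gamma(x+1)}\biggl(\frac{x+1/2}{e}\biggr)^{x+1/2}\biggr]^{8x^2}e^{-x/3},$$ and $$\biggl[\frac{\Gamma(x+1)}{\sqrt{2\pi}}\biggl(\frac{e}{x+1/2}\biggr)^{x+1/2}\biggr]^{16x^3}e^{x(2x-1)/3}$$ are logarithmically completely monotonic on $(0,\infty)$. The five functions $$\frac{\sqrt{2\pi}}{\Gamma(x+1)}\biggl(\frac{x+1/2}{e}\biggr)^{x+1/2},\qquad \biggl[\frac{\Gamma(x+1)}{\sqrt{2\pi}}\biggl(\frac{e}{x+1/2}\biggr)^{x+1/2}\biggr]^{2x+1},$$ $$\biggl[\frac{\sqrt{2\pi}}{\Gamma(x+1)}\biggl(\frac{x+1/2}{e}\biggr)^{x+1/2}\biggr]^{x+1},\qquad \biggl[\frac{\sqrt{2\pi}}{\Gamma(x+1)}\biggl(\frac{x+1/2}{e}\biggr)^{x+1/2}\biggr]^{(x+1)^2}e^{-x/24},$$ and $$\biggl[\frac{\sqrt{2\pi}}{\Gamma(x+1)}\biggl(\frac{x+1/2}{e}\biggr)^{x+1/2}\biggr]^{(x+1)^3}e^{-x(2x+5)/48}$$ are logarithmically completely monotonic on $\bigl(-\frac12,\infty\bigr)$.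
   Context: $\Gamma$ is Euler's gamma function. A positive function $f$ is logarithmically completely monotonic on an interval $I\subseteq\mathbb{R}$ if it has derivatives of all orders on $I$ and $(-1)^k[\ln f(x)]^{(k)}\ge0$ for all $x\in I$ and all integers $k\ge1$. *)

theory Defs
  imports "HOL-Analysis.Analysis"
begin

text \<open>
  Derivatives are taken within \<open>I\<close>, so they are one-sided at an endpoint that belongs to \<open>I\<close>.
  On an open set this is \<open>(deriv ^^ k) f\<close>; see \<open>nth_deriv_on_open\<close> below.
\<close>

primrec nth_deriv_on :: "real set \<Rightarrow> nat \<Rightarrow> (real \<Rightarrow> real) \<Rightarrow> real \<Rightarrow> real" where
  "nth_deriv_on I 0 f = f"
| "nth_deriv_on I (Suc k) f = (\<lambda>x. vector_derivative (nth_deriv_on I k f) (at x within I))"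

definition has_derivs_of_all_orders_on :: "(real \<Rightarrow> real) \<Rightarrow> real set \<Rightarrow> bool" where
  "has_derivs_of_all_orders_on f I \<longleftrightarrow> (\<forall>k. nth_deriv_on I k f differentiable_on I)"

text \<open>
  An interval is understood to be nondegenerate: at an isolated point every number is a
  derivative, so \<^const>\<open>vector_derivative\<close> within a singleton carries no information.
\<close>

definition log_completely_monotonic_on :: "(real \<Rightarrow> real) \<Rightarrow> real set \<Rightarrow> bool" where
  "log_completely_monotonic_on f I \<longleftrightarrow>
     is_interval I \<and> interior I \<noteq> {} \<and>
     (\<forall>x\<in>I. f x > 0) \<and>
     has_derivs_of_all_orders_on f I \<and>
     (\<forall>k\<ge>1. \<forall>x\<in>I. (-1) ^ k * nth_deriv_on I k (\<lambda>t. ln (f t)) x \<ge> 0)"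

lemma nth_deriv_on_open:
  assumes "open I" "x \<in> I"
  shows "nth_deriv_on I k f x = (deriv ^^ k) f x"
  using assms(2)
proof (induction k arbitrary: x)
  case (Suc k)
  have "eventually (\<lambda>y. nth_deriv_on I k f y = (deriv ^^ k) f y) (nhds x)"
    unfolding eventually_nhds using Suc.IH Suc.prems assms(1) by blast
  then have "deriv (nth_deriv_on I k f) x = deriv ((deriv ^^ k) f) x"
    by (intro deriv_cong_ev) auto
  moreover have "vector_derivative (nth_deriv_on I k f) (at x within I) = deriv (nth_deriv_on I k f) x"
    unfolding vector_derivative_def deriv_def at_within_open[OF Suc.prems assms(1)]
      has_real_derivative_iff_has_vector_derivative ..
  ultimately show ?case
    by simp
qed simp

end

theory Submission
  imports Defs "HOL-Real_Asymp.Real_Asymp"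
begin

text \<open>
  Let \<open>\<theta> x = ln (sqrt (2\<pi>) / \<Gamma>(x + 1) * ((x + 1/2) / e) powr (x + 1/2))\<close> be the remainder in
  Burnside's formula. The logarithm of each of the eight functions is \<open>p(x) \<theta>(x) + r(x)\<close> with
  polynomials \<open>p\<close> and \<open>r\<close>. A Binet-type formula makes this manageable: for \<open>x > -1/2\<close>,
  \<open>\<theta>\<close> is the Laplace transform \<open>L[s](x)\<close> of \<open>s(t) = exp(-t/2)/t^2 - 1/(t (exp t - 1))\<close> over \<open>t > 0\<close>
  (\<open>burnside_remainder_laplace\<close>).

  Integration by parts gives \<open>x L[f](x) = f(0+) + L[f'](x)\<close>. Hence multiplying \<open>\<theta>\<close> by \<open>x + c\<close> replaces
  the weight \<open>s\<close> by \<open>s' + c s\<close>, up to a boundary constant. The factors \<open>exp(r(x))\<close> in the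
  functions are exactly those that cancel the boundary terms of positive degree in \<open>x\<close>. So the eight
  logarithms are, up to additive constants, the Laplace transforms of
  \<open>-s'\<close>, \<open>8 s''\<close>, \<open>-16 s'''\<close>, \<open>s\<close>, \<open>-(2 s' + s)\<close>, \<open>s' + s\<close>, \<open>s'' + 2 s' + s\<close> and
  \<open>s''' + 3 s'' + 3 s' + s\<close>. Differentiating \<open>k\<close> times under the integral multiplies the weight by
  \<open>(-t)^k\<close>, so logarithmic complete monotonicity follows once each weight is nonnegative
  (\<open>log_completely_monotonic_on_exp_laplace\<close>).

  The signs come from four inequalities: \<open>s \<ge> 0\<close>, \<open>2 s' + s \<le> 0\<close>, \<open>s''' \<le> 0\<close> and
  \<open>s''' + 3 s'' + 3 s' + s \<ge> 0\<close>. From \<open>s''' \<le> 0\<close> follow \<open>s'' \<ge> 0\<close> and then \<open>s' \<le> 0\<close>, because \<open>s''\<close>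
  and \<open>s'\<close> vanish at infinity. The weights \<open>s' + s\<close>, \<open>s'' + 2 s' + s\<close> and \<open>s''' + 3 s'' + 3 s' + s\<close> are
  \<open>exp(-t)\<close> times the first three derivatives of \<open>exp(t) s(t)\<close>; the last one being nonnegative, so are
  the other two, because those derivatives have positive limits at \<open>0\<close>. After clearing denominators,
  each of the four inequalities says that an exponential polynomial \<open>\<Sum>p\<^sub>j(y) exp(j y)\<close> is nonnegative
  for \<open>y \<ge> 0\<close>, and \<open>exp_poly_nonneg\<close> proves this by repeatedly applying operators \<open>d/dy - k\<close>.

  Binet's formula itself is proved by comparing \<open>\<theta>\<close> with \<open>L[s]\<close>. The second derivative of \<open>\<theta> - L[s]\<close>
  has period \<open>1\<close> and tends to \<open>0\<close>, so it vanishes. The difference is therefore affine; the functional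
  equation of \<open>\<Gamma>\<close> shows that its slope is \<open>0\<close>, and Legendre's duplication formula that its
  constant term is \<open>0\<close>.
\<close>

section \<open>Positivity of exponential polynomials\<close>

text \<open>
  An exponential polynomial \<open>\<Sum>p\<^sub>j(y) exp(j y)\<close> is listed as the pairs \<open>(j, p\<^sub>j)\<close>, so that the
  positivity criterion below becomes a finite computation with coefficients.
\<close>

definition exp_poly :: "(real \<times> real poly) list \<Rightarrow> real \<Rightarrow> real" where
  "exp_poly F y = (\<Sum>(j, p)\<leftarrow>F. poly p y * exp (j * y))"

text \<open>
  The operator \<open>d/dy - k\<close> on the listed coefficients. Applied with \<open>k = j\<close> it lowers the
  degree of \<open>p\<^sub>j\<close>, so \<open>degree p\<^sub>j + 1\<close> applications remove the exponent \<open>j\<close>.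
\<close>

definition twisted_deriv :: "real \<Rightarrow> (real \<times> real poly) list \<Rightarrow> (real \<times> real poly) list" where
  "twisted_deriv k F = map (\<lambda>(j, p). (j, pderiv p + smult (j - k) p)) F"

fun nonneg_ladder :: "real list \<Rightarrow> (real \<times> real poly) list \<Rightarrow> bool" where
  "nonneg_ladder [] F \<longleftrightarrow> list_all (\<lambda>(j, p). list_all (\<lambda>c. 0 \<le> c) (coeffs p)) F"
| "nonneg_ladder (k # ks) F \<longleftrightarrow>
     0 \<le> (\<Sum>(j, p)\<leftarrow>F. coeff p 0) \<and> nonneg_ladder ks (twisted_deriv k F)"

lemma exp_poly_has_derivative:
  "(exp_poly F has_real_derivative (k * exp_poly F y + exp_poly (twisted_deriv k F) y)) (at y)"
proof (induction F)
  case Nil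
  have "exp_poly [] = (\<lambda>_. 0)"
    by (simp add: exp_poly_def fun_eq_iff)
  then show ?case
    by (simp add: exp_poly_def twisted_deriv_def)
next
  case (Cons a F)
  obtain j p where a: "a = (j, p)"
    by (cases a)
  have split: "exp_poly (a # F) = (\<lambda>y. poly p y * exp (j * y) + exp_poly F y)"
    by (simp add: exp_poly_def a fun_eq_iff)
  show ?case
    unfolding split
    by (rule derivative_eq_intros poly_DERIV Cons.IH refl)+
       (simp add: exp_poly_def twisted_deriv_def a algebra_simps)
qed

text \<open>
  If \<open>F 0 \<ge> 0\<close> and \<open>F' - k F \<ge> 0\<close> on the half-line, then \<open>exp(- k y) F y\<close> increases from a
  nonnegative value, so \<open>F \<ge> 0\<close>. A ladder of such steps ends at an exponential polynomial
  whose coefficients are all nonnegative.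
\<close>

lemma exp_poly_nonneg:
  assumes "nonneg_ladder ks F" "0 \<le> y"
  shows "0 \<le> exp_poly F y"
  using assms
proof (induction ks arbitrary: F y)
  case Nil
  have "0 \<le> (\<Sum>x\<leftarrow>F. case x of (j, p) \<Rightarrow> poly p y * exp (j * y))"
  proof (rule sum_list_nonneg)
    fix z assume "z \<in> set (map (\<lambda>x. case x of (j, p) \<Rightarrow> poly p y * exp (j * y)) F)"
    then obtain j p where jp: "(j, p) \<in> set F" "z = poly p y * exp (j * y)"
      by auto
    have "\<forall>c\<in>set (coeffs p). 0 \<le> c"
      using Nil.prems(1) jp(1) by (auto simp: list_all_iff)
    then have "0 \<le> horner_sum id y (coeffs p)"
      using Nil.prems(2) by (induct ("coeffs p")) simp_all
    then show "0 \<le> z"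
      using jp(2) by (simp add: poly_def)
  qed
  then show ?case
    by (simp add: exp_poly_def)
next
  case (Cons k ks)
  have "exp (- k * 0) * exp_poly F 0 \<le> exp (- k * y) * exp_poly F y"
  proof (rule DERIV_nonneg_imp_nondecreasing[OF Cons.prems(2)])
    fix x assume x: "0 \<le> x" "x \<le> y"
    have "((\<lambda>x. exp (- k * x) * exp_poly F x) has_real_derivative
            exp (- k * x) * exp_poly (twisted_deriv k F) x) (at x)"
      by (rule derivative_eq_intros exp_poly_has_derivative[of _ k] refl)+ (simp add: algebra_simps)
    moreover have "0 \<le> exp_poly (twisted_deriv k F) x"
      using Cons.IH[of "twisted_deriv k F" x] Cons.prems(1) x(1) by simp
    ultimately show "\<exists>d. ((\<lambda>x. exp (- k * x) * exp_poly F x) has_real_derivative d) (at x) \<and> 0 \<le> d"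
      by (meson exp_ge_zero mult_nonneg_nonneg)
  qed
  moreover have "exp_poly F 0 = (\<Sum>(j, p)\<leftarrow>F. coeff p 0)"
    by (simp add: exp_poly_def poly_0_coeff_0)
  ultimately have "0 \<le> exp (- k * y) * exp_poly F y"
    using Cons.prems(1) by simp
  then show ?case
    by (simp add: zero_le_mult_iff not_le[symmetric])
qed

section \<open>The kernel and its third-order sign conditions\<close>

text \<open>
  The derivatives of \<open>1 / (exp t - 1)\<close> are polynomials in the function itself, since
  \<open>bose' = - bose (1 + bose)\<close>; the derivatives of the kernel are written in this form.
\<close>

definition bose :: "real \<Rightarrow> real" where
  "bose t = 1 / (exp t - 1)"

definition kernel :: "real \<Rightarrow> real" where
  "kernel t = exp (- t / 2) / t ^ 2 - bose t / t"

definition kernel' :: "real \<Rightarrow> real" where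
  "kernel' t = - exp (- t / 2) * (t + 4) / (2 * t ^ 3)
     + (bose t * (1 + bose t) / t + bose t / t ^ 2)"

definition kernel'' :: "real \<Rightarrow> real" where
  "kernel'' t = exp (- t / 2) * (t ^ 2 + 8 * t + 24) / (4 * t ^ 4)
     - (bose t * (1 + bose t) * (1 + 2 * bose t) / t + 2 * bose t * (1 + bose t) / t ^ 2
        + 2 * bose t / t ^ 3)"

definition kernel''' :: "real \<Rightarrow> real" where
  "kernel''' t = - exp (- t / 2) * (t ^ 3 + 12 * t ^ 2 + 72 * t + 192) / (8 * t ^ 5)
     + (bose t * (1 + bose t) * (1 + 6 * bose t + 6 * bose t ^ 2) / t
        + 3 * bose t * (1 + bose t) * (1 + 2 * bose t) / t ^ 2
        + 6 * bose t * (1 + bose t) / t ^ 3 + 6 * bose t / t ^ 4)"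

lemma bose_has_derivative:
  assumes "t > 0"
  shows "(bose has_real_derivative - bose t * (1 + bose t)) (at t)"
proof -
  have "((\<lambda>t. 1 / (exp t - 1)) has_real_derivative - bose t * (1 + bose t)) (at t)"
    using assms by (auto intro!: derivative_eq_intros simp: bose_def divide_simps power2_eq_square)
  then show ?thesis
    by (simp add: bose_def[abs_def])
qed

lemma kernel_has_derivative: "t > 0 \<Longrightarrow> (kernel has_real_derivative kernel' t) (at t)"
  unfolding kernel_def[abs_def] kernel'_def
  by (rule derivative_eq_intros bose_has_derivative refl | simp)+
     (simp add: divide_simps eval_nat_numeral, simp add: algebra_simps)

lemma kernel'_has_derivative: "t > 0 \<Longrightarrow> (kernel' has_real_derivative kernel'' t) (at t)"
  unfolding kernel'_def[abs_def] kernel''_def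
  by (rule derivative_eq_intros bose_has_derivative refl | simp)+
     (simp add: divide_simps eval_nat_numeral, simp add: algebra_simps)

lemma kernel''_has_derivative: "t > 0 \<Longrightarrow> (kernel'' has_real_derivative kernel''' t) (at t)"
  unfolding kernel''_def[abs_def] kernel'''_def
  by (rule derivative_eq_intros bose_has_derivative refl | simp)+
     (simp add: divide_simps eval_nat_numeral, simp add: algebra_simps)

lemma exp_numeral_mult: "exp (numeral n * x) = exp (x :: real) ^ numeral n"
  by (metis exp_of_nat_mult of_nat_numeral)

lemma bose_double: "bose (2 * y) = 1 / (exp y ^ 2 - 1)"
  by (simp add: bose_def exp_numeral_mult)

text \<open>
  In each of the following inequalities put \<open>t = 2 y\<close> and \<open>w = exp y\<close>. Multiplying by a power
  of \<open>t\<close>, a power of \<open>u = w^2 - 1 = exp t - 1\<close> and \<open>w\<close> turns the kernel terms into an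
  exponential polynomial in \<open>y\<close>. Each ladder takes the exponents in increasing order, as many
  times as needed to remove them one after another; the values at \<open>0\<close> that it tests vanish at
  first, because the poles of the kernel cancel, and any later ones are positive.
\<close>

lemma kernel_nonneg:
  assumes "t > 0"
  shows "0 \<le> kernel t"
proof -
  define y where "y = t / 2"
  have t: "t = 2 * y" and y: "y > 0"
    using assms by (simp_all add: y_def)
  define w where "w = exp y"
  have w: "w > 1" using y by (simp add: w_def)
  then have w2: "w^2 > 1" "w * w \<noteq> 1"
    by (simp_all add: power2_eq_square less_1_mult order_less_imp_not_eq2)
  have "nonneg_ladder [0, 1, 1] [(0, [:-1:]), (1, [:0, -2:]), (2, [:1:])]"
    by (simp add: twisted_deriv_def pderiv_pCons)
  from exp_poly_nonneg[OF this, of y] have "0 \<le> w^2 - 1 - t * w"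
    using y by (simp add: t exp_poly_def exp_numeral_mult w_def[symmetric])
  also have "\<dots> = kernel t * (t^2 * (w^2 - 1) * w)"
    using y w w2 by (simp add: t kernel_def bose_double exp_minus w_def[symmetric] divide_simps)
      (simp add: algebra_simps power2_eq_square)
  finally have *: "0 \<le> kernel t * (t^2 * (w^2 - 1) * w)" .
  have "0 < t^2 * (w^2 - 1) * w" using assms w w2 by simp
  with * show ?thesis by (simp add: zero_le_mult_iff)
qed

text \<open>
  The function \<open>exp(t/2) kernel t = 1/t^2 - 1/(2 t sinh(t/2))\<close> is decreasing; twice its
  derivative is \<open>exp(t/2) (2 kernel' t + kernel t)\<close>. In terms of \<open>y = t/2\<close> the claim is
  \<open>y sinh y + y^2 cosh y \<le> 2 (sinh y)^2\<close>.
\<close>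

lemma two_kernel'_plus_kernel_nonpos:
  assumes "t > 0"
  shows "2 * kernel' t + kernel t \<le> 0"
proof -
  define y where "y = t / 2"
  have t: "t = 2 * y" and y: "y > 0"
    using assms by (simp_all add: y_def)
  define w where "w = exp y"
  have w: "w > 1" using y by (simp add: w_def)
  then have w2: "w^2 > 1" "w * w \<noteq> 1"
    by (simp_all add: power2_eq_square less_1_mult order_less_imp_not_eq2)
  have "nonneg_ladder [0, 1, 1, 1, 2, 3, 3, 3]
     [(0,[:1:]),(1,[:0,1,-1:]),(2,[:-2:]),(3,[:0,-1,-1:]),(4,[:1:])]"
    by (simp add: twisted_deriv_def pderiv_pCons)
  from exp_poly_nonneg[OF this, of y]
  have "0 \<le> 4 * (w^2 - 1)^2 - t^2 * w * (w^2 + 1) - 2 * t * w * (w^2 - 1)"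
    using y by (simp add: t exp_poly_def exp_numeral_mult w_def[symmetric])
      (simp add: field_simps power2_eq_square eval_nat_numeral)
  also have "\<dots> = -(2 * kernel' t + kernel t) * (t^3 * (w^2 - 1)^2 * w)"
    using y w w2 by (simp add: t kernel_def kernel'_def bose_double exp_minus w_def[symmetric] divide_simps)
      (simp add: algebra_simps eval_nat_numeral)
  finally show ?thesis using assms w w2 by (simp add: zero_le_mult_iff mult_le_0_iff)
qed

lemma kernel'''_nonpos:
  assumes "t > 0"
  shows "kernel''' t \<le> 0"
proof -
  define y where "y = t / 2"
  have t: "t = 2 * y" and y: "y > 0"
    using assms by (simp_all add: y_def)
  define w where "w = exp y"
  have w: "w > 1" using y by (simp add: w_def)
  then have w2: "w^2 > 1" by simp
  define u where "u = w^2 - 1"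
  have u: "u > 0" using w2 by (simp add: u_def)
  have "nonneg_ladder
  [0,0,0,0, 1,1, 2,2,2,2, 3,3,3,3,3, 4,4,4,4, 5,5,5,5,5, 6,6,6,6, 7,7,7,7,7]
 [(0, [:24, 18, 6, 1:]), (1, [:0, 12:]), (2, [:-96, -72, -24, -4:]), (3, [:0, -36, -24, 24, -16:]),
  (4, [:144, 108, 36, 6:]), (5, [:0, 36, 48, 0, -64:]), (6, [:-96, -72, -24, -4:]),
  (7, [:0, -12, -24, -24, -16:]), (8, [:24, 18, 6, 1:])]"
    by (simp add: twisted_deriv_def pderiv_pCons)
  from exp_poly_nonneg[OF this, of y]
  have "0 \<le> u^4 * (t^3 + 12 * t^2 + 72 * t + 192)
     - 8 * w * (t^4 * (1+u) * ((1+u)^2 + 4 * (1+u) + 1) + 3 * t^3 * (1+u) * u * (u+2)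
          + 6 * t^2 * (1+u) * u^2 + 6 * t * u^3)"
    using y by (simp add: t exp_poly_def exp_numeral_mult w_def[symmetric] u_def)
      (simp add: field_simps power2_eq_square eval_nat_numeral)
  also have "\<dots> = - kernel''' t * (8 * t^5 * u^4 * w)"
    using y w u by (simp add: t kernel'''_def bose_double exp_minus w_def[symmetric] u_def[symmetric] divide_simps)
      (simp add: algebra_simps eval_nat_numeral)
  finally show ?thesis using assms w u by (simp add: zero_le_mult_iff mult_le_0_iff)
qed

text \<open>
  The expression \<open>exp(t/2) kernel t\<close> is even in \<open>t\<close>, so the formula for the kernel satisfies
  \<open>exp t * kernel t = kernel (- t)\<close>. The sum below is \<open>exp(- t)\<close> times the third derivative of
  this function, namely \<open>- exp(- t) kernel'''(- t)\<close>. So this is the preceding inequality continued to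
  negative arguments.
\<close>

lemma kernel_binomial_sum3_nonneg:
  assumes "t > 0"
  shows "0 \<le> kernel''' t + 3 * kernel'' t + 3 * kernel' t + kernel t"
proof -
  define y where "y = t / 2"
  have t: "t = 2 * y" and y: "y > 0"
    using assms by (simp_all add: y_def)
  define w where "w = exp y"
  have w: "w > 1" using y by (simp add: w_def)
  then have w2: "w^2 > 1" by simp
  define u where "u = w^2 - 1"
  have u: "u > 0" using w2 by (simp add: u_def)
  have "nonneg_ladder
  [0,0,0,0, 1,1,1,1,1, 2,2,2,2, 3,3,3,3,3, 4,4,4,4, 5,5,5,5,5, 6,6,6,6, 7,7]
 [(0, [:-24, 18, -6, 1:]), (1, [:0, -12, 24, -24, 16:]), (2, [:96, -72, 24, -4:]),
  (3, [:0, 36, -48, 0, 64:]), (4, [:-144, 108, -36, 6:]), (5, [:0, -36, 24, 24, 16:]),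
  (6, [:96, -72, 24, -4:]), (7, [:0, 12:]), (8, [:-24, 18, -6, 1:])]"
    by (simp add: twisted_deriv_def pderiv_pCons)
  from exp_poly_nonneg[OF this, of y]
  have "0 \<le> u^4 * (t^3 - 12 * t^2 + 72 * t - 192)
     + 8 * w * (t^4 * ((1+u)^2 + 4 * (1+u) + 1) + 3 * t^3 * u * (u+2)
          + 6 * t^2 * u^2 + 6 * t * u^3)"
    using y by (simp add: t exp_poly_def exp_numeral_mult w_def[symmetric] u_def)
      (simp add: field_simps power2_eq_square eval_nat_numeral)
  also have "\<dots> = (kernel''' t + 3 * kernel'' t + 3 * kernel' t + kernel t) * (8 * t^5 * u^4 * w)"
    using y w u by (simp add: t kernel'''_def kernel''_def kernel'_def kernel_def bose_double exp_minus
         w_def[symmetric] u_def[symmetric] divide_simps)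
      (simp add: algebra_simps eval_nat_numeral)
  finally show ?thesis using assms w u by (simp add: zero_le_mult_iff mult_le_0_iff)
qed

section \<open>Limits of the kernel and the lower-order sign conditions\<close>

text \<open>
  The poles cancel at \<open>0\<close>, where the limits are the boundary terms of the later integrations
  by parts. The limits at infinity carry the weight \<open>exp(t/2)\<close>, which is what makes the
  Laplace transforms converge on all of \<open>x > -1/2\<close>.
\<close>

lemma kernel_at_0: "(kernel \<longlongrightarrow> 1 / 24) (at_right 0)"
  unfolding kernel_def[abs_def] bose_def by real_asymp

lemma kernel'_at_0: "(kernel' \<longlongrightarrow> - 1 / 48) (at_right 0)"
  unfolding kernel'_def[abs_def] bose_def by real_asymp

lemma kernel''_at_0: "(kernel'' \<longlongrightarrow> 23 / 2880) (at_right 0)"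
  unfolding kernel''_def[abs_def] bose_def by real_asymp

lemma kernel'''_at_0: "(kernel''' \<longlongrightarrow> - 1 / 640) (at_right 0)"
  unfolding kernel'''_def[abs_def] bose_def by real_asymp

lemma kernel_at_top: "((\<lambda>t. kernel t * exp (1 / 2 * t)) \<longlongrightarrow> 0) at_top"
  unfolding kernel_def[abs_def] bose_def by real_asymp

lemma kernel'_at_top: "((\<lambda>t. kernel' t * exp (1 / 2 * t)) \<longlongrightarrow> 0) at_top"
  unfolding kernel'_def[abs_def] bose_def by real_asymp

lemma kernel''_at_top: "((\<lambda>t. kernel'' t * exp (1 / 2 * t)) \<longlongrightarrow> 0) at_top"
  unfolding kernel''_def[abs_def] bose_def by real_asymp

lemma kernel'''_at_top: "((\<lambda>t. kernel''' t * exp (1 / 2 * t)) \<longlongrightarrow> 0) at_top"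
  unfolding kernel'''_def[abs_def] bose_def by real_asymp

lemma nonneg_if_decreasing_to_0:
  fixes f :: "real \<Rightarrow> real"
  assumes "\<And>t. 0 < t \<Longrightarrow> (f has_real_derivative f' t) (at t)" "\<And>t. 0 < t \<Longrightarrow> f' t \<le> 0"
    and "(f \<longlongrightarrow> 0) at_top" "0 < t"
  shows "0 \<le> f t"
proof (rule tendsto_upperbound[OF assms(3)])
  have "f u \<le> f t" if "t \<le> u" for u
  proof (rule DERIV_nonpos_imp_nonincreasing[OF that])
    fix v assume "t \<le> v"
    then have "0 < v" using \<open>0 < t\<close> by simp
    then show "\<exists>y. (f has_real_derivative y) (at v) \<and> y \<le> 0"
      using assms(1,2) by (intro exI[of _ "f' v"] conjI)
  qed
  then show "\<forall>\<^sub>F u in at_top. f u \<le> f t"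
    by (rule eventually_mono[OF eventually_ge_at_top[of t]])
qed simp

lemma nonneg_if_increasing_from_nonneg:
  fixes f :: "real \<Rightarrow> real"
  assumes "\<And>t. 0 < t \<Longrightarrow> (f has_real_derivative f' t) (at t)" "\<And>t. 0 < t \<Longrightarrow> 0 \<le> f' t"
    and "(f \<longlongrightarrow> l) (at_right 0)" "0 \<le> l" "0 < t"
  shows "0 \<le> f t"
proof -
  have "l \<le> f t"
  proof (rule tendsto_upperbound[OF assms(3)])
    have "f u \<le> f t" if "0 < u" "u \<le> t" for u
    proof (rule DERIV_nonneg_imp_nondecreasing[OF that(2)])
      fix v assume "u \<le> v"
      then have "0 < v" using that(1) by simp
      then show "\<exists>y. (f has_real_derivative y) (at v) \<and> 0 \<le> y"
        using assms(1,2) by (intro exI[of _ "f' v"] conjI)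
    qed
    then show "\<forall>\<^sub>F u in at_right 0. f u \<le> f t"
      unfolding eventually_at_right_field using \<open>0 < t\<close> by (intro exI[of _ t]) auto
  qed simp
  with \<open>0 \<le> l\<close> show ?thesis by simp
qed

lemma tendsto_0_of_exp_mult:
  fixes f :: "real \<Rightarrow> real"
  assumes "((\<lambda>t. f t * exp (1 / 2 * t)) \<longlongrightarrow> m) at_top"
  shows "(f \<longlongrightarrow> 0) at_top"
proof -
  have "((\<lambda>t. f t * exp (1 / 2 * t) * exp (- (1 / 2 * t))) \<longlongrightarrow> m * 0) at_top"
    by (rule tendsto_mult[OF assms]) real_asymp
  moreover have "f t * exp (1 / 2 * t) * exp (- (1 / 2 * t)) = f t" for t
    by (simp add: exp_minus)
  ultimately show ?thesis
    by (simp only: mult_zero_right)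
qed

lemma kernel''_nonneg: "0 < t \<Longrightarrow> 0 \<le> kernel'' t"
  by (rule nonneg_if_decreasing_to_0[OF kernel''_has_derivative kernel'''_nonpos
        tendsto_0_of_exp_mult[OF kernel''_at_top]])

lemma kernel'_nonpos:
  assumes "0 < t"
  shows "kernel' t \<le> 0"
proof -
  have "0 \<le> - kernel' t"
  proof (rule nonneg_if_decreasing_to_0[where f = "\<lambda>t. - kernel' t"])
    show "((\<lambda>t. - kernel' t) has_real_derivative - kernel'' t) (at t)" if "0 < t" for t
      using kernel'_has_derivative[OF that] by (rule DERIV_minus)
    show "((\<lambda>t. - kernel' t) \<longlongrightarrow> 0) at_top"
      using tendsto_minus[OF tendsto_0_of_exp_mult[OF kernel'_at_top]] by simp
  qed (use kernel''_nonneg assms in auto)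
  then show ?thesis by simp
qed

text \<open>
  By the preceding section \<open>exp t * kernel t\<close> has a nonnegative third derivative. Its first
  two derivatives start at \<open>0\<close> from the values \<open>1/48\<close> and \<open>23/2880\<close>, so they are nonnegative
  as well.
\<close>

lemma kernel_binomial_sum2_nonneg:
  assumes "0 < t"
  shows "0 \<le> kernel'' t + 2 * kernel' t + kernel t"
proof -
  have "0 \<le> exp t * (kernel'' t + 2 * kernel' t + kernel t)"
  proof (rule nonneg_if_increasing_from_nonneg[where f = "\<lambda>t. exp t * (kernel'' t + 2 * kernel' t + kernel t)"])
    show "((\<lambda>t. exp t * (kernel'' t + 2 * kernel' t + kernel t)) has_real_derivative
        exp t * (kernel''' t + 3 * kernel'' t + 3 * kernel' t + kernel t)) (at t)" if "0 < t" for t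
      using that
      by (auto intro!: derivative_eq_intros kernel_has_derivative kernel'_has_derivative kernel''_has_derivative simp: algebra_simps)
    show "((\<lambda>t. exp t * (kernel'' t + 2 * kernel' t + kernel t)) \<longlongrightarrow> 23 / 2880) (at_right 0)"
      by (auto intro!: tendsto_eq_intros kernel_at_0 kernel'_at_0 kernel''_at_0)
  qed (use kernel_binomial_sum3_nonneg assms in auto)
  then show ?thesis by (simp add: zero_le_mult_iff)
qed

lemma kernel_binomial_sum1_nonneg:
  assumes "0 < t"
  shows "0 \<le> kernel' t + kernel t"
proof -
  have "0 \<le> exp t * (kernel' t + kernel t)"
  proof (rule nonneg_if_increasing_from_nonneg[where f = "\<lambda>t. exp t * (kernel' t + kernel t)"])
    show "((\<lambda>t. exp t * (kernel' t + kernel t)) has_real_derivative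
        exp t * (kernel'' t + 2 * kernel' t + kernel t)) (at t)" if "0 < t" for t
      using that
      by (auto intro!: derivative_eq_intros kernel_has_derivative kernel'_has_derivative simp: algebra_simps)
    show "((\<lambda>t. exp t * (kernel' t + kernel t)) \<longlongrightarrow> 1 / 48) (at_right 0)"
      by (auto intro!: tendsto_eq_intros kernel_at_0 kernel'_at_0)
  qed (use kernel_binomial_sum2_nonneg assms in auto)
  then show ?thesis by (simp add: zero_le_mult_iff)
qed

section \<open>Laplace transforms on a half-line\<close>

definition laplace :: "(real \<Rightarrow> real) \<Rightarrow> real \<Rightarrow> real" where
  "laplace w x = (LINT t:{0<..}|lborel. w t * exp (- (x * t)))"

text \<open>
  Convergence at every point to the right of \<open>a\<close>, rather than at one point, leaves room for
  the factor \<open>t\<close> that differentiation produces, so the condition is inherited by all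
  derivatives.
\<close>

definition laplace_integrable :: "real \<Rightarrow> (real \<Rightarrow> real) \<Rightarrow> bool" where
  "laplace_integrable a w \<longleftrightarrow> (\<forall>x>a. set_integrable lborel {0<..} (\<lambda>t. w t * exp (- (x * t))))"

lemma laplace_integrableD:
  "laplace_integrable a w \<Longrightarrow> a < x \<Longrightarrow> set_integrable lborel {0<..} (\<lambda>t. w t * exp (- (x * t)))"
  by (simp add: laplace_integrable_def)

lemma laplace_integrable_mono: "laplace_integrable a w \<Longrightarrow> a \<le> b \<Longrightarrow> laplace_integrable b w"
  by (simp add: laplace_integrable_def)

lemma laplace_integrable_add:
  "laplace_integrable a v \<Longrightarrow> laplace_integrable a w \<Longrightarrow> laplace_integrable a (\<lambda>t. v t + w t)"
  by (simp add: laplace_integrable_def distrib_right)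

lemma laplace_integrable_cmult:
  "laplace_integrable a w \<Longrightarrow> laplace_integrable a (\<lambda>t. c * w t)"
  by (simp add: laplace_integrable_def mult.assoc)

lemma laplace_add:
  "laplace_integrable a v \<Longrightarrow> laplace_integrable a w \<Longrightarrow> a < x \<Longrightarrow>
    laplace (\<lambda>t. v t + w t) x = laplace v x + laplace w x"
  by (simp add: laplace_def laplace_integrable_def distrib_right)

lemma laplace_cmult: "laplace (\<lambda>t. c * w t) x = c * laplace w x"
  by (simp add: laplace_def mult.assoc)

lemma laplace_nonneg: "(\<And>t. t > 0 \<Longrightarrow> 0 \<le> w t) \<Longrightarrow> 0 \<le> laplace w x"
  unfolding laplace_def set_lebesgue_integral_def
  by (intro Bochner_Integration.integral_nonneg) (simp add: indicator_def)

lemma set_borel_measurable_mult_left: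
  fixes f g :: "real \<Rightarrow> real"
  assumes "f \<in> borel_measurable M" "set_borel_measurable M A g"
  shows "set_borel_measurable M A (\<lambda>t. f t * g t)"
proof -
  have "(\<lambda>t. f t * (indicator A t *\<^sub>R g t)) \<in> borel_measurable M"
    using assms by (intro borel_measurable_times) (auto simp: set_borel_measurable_def)
  then show ?thesis
    by (simp add: set_borel_measurable_def mult.left_commute)
qed

text \<open>
  Half of the distance from \<open>x\<close> to \<open>a\<close> is spent on absorbing \<open>t\<close> into an exponential:
  \<open>t exp(- d t) \<le> 1/d\<close>.
\<close>

lemma laplace_integrable_times_t:
  assumes "laplace_integrable a w"
  shows "laplace_integrable a (\<lambda>t. t * w t)"
  unfolding laplace_integrable_def
proof (intro allI impI)
  fix x assume "a < x"
  define d where "d = (x - a) / 2"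
  have d: "0 < d" "a < x - d"
    using \<open>a < x\<close> by (simp_all add: d_def field_simps)
  let ?g = "\<lambda>t. w t * exp (- ((x - d) * t))"
  have int: "set_integrable lborel {0<..} ?g"
    using assms d(2) by (rule laplace_integrableD)
  have eq: "t * w t * exp (- (x * t)) = t * exp (- (d * t)) * ?g t" for t
    by (simp add: mult_exp_exp algebra_simps)
  show "set_integrable lborel {0<..} (\<lambda>t. t * w t * exp (- (x * t)))"
    unfolding eq
  proof (rule set_integrable_bound)
    show "set_integrable lborel {0<..} (\<lambda>t. 1 / d * ?g t)"
      using int by simp
    show "set_borel_measurable lborel {0<..} (\<lambda>t. t * exp (- (d * t)) * ?g t)"
    proof (rule set_borel_measurable_mult_left)
      show "set_borel_measurable lborel {0<..} ?g"
        using int unfolding set_integrable_def set_borel_measurable_def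
        by (rule borel_measurable_integrable)
    qed measurable
    have "\<bar>t * exp (- (d * t)) * ?g t\<bar> \<le> \<bar>1 / d * ?g t\<bar>" if "0 < t" for t
    proof -
      have "d * t \<le> exp (d * t)"
        using exp_ge_add_one_self[of "d * t"] by linarith
      then have "t * exp (- (d * t)) \<le> 1 / d"
        using d by (simp add: exp_minus field_simps)
      then have "\<bar>t * exp (- (d * t))\<bar> \<le> \<bar>1 / d\<bar>"
        using that d by simp
      then show ?thesis
        unfolding abs_mult[of _ "?g t"] by (rule mult_right_mono) simp
    qed
    then show "AE t in lborel. t \<in> {0<..} \<longrightarrow> norm (t * exp (- (d * t)) * ?g t) \<le> norm (1 / d * ?g t)"
      by auto
  qed
qed

lemma laplace_integrable_power:
  "laplace_integrable a w \<Longrightarrow> laplace_integrable a (\<lambda>t. t ^ k * w t)"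
proof (induction k)
  case (Suc k)
  then show ?case
    using laplace_integrable_times_t[of a "\<lambda>t. t ^ k * w t"] by (simp add: mult.assoc)
qed simp

lemma exp_taylor1_bound: "\<bar>exp u - 1 - u\<bar> \<le> u\<^sup>2 * exp \<bar>u\<bar>" for u :: real
proof -
  have lower: "0 \<le> exp u - 1 - u"
    using exp_ge_add_one_self[of u] by linarith
  have secant: "exp v - 1 \<le> v * exp v" for v :: real
    using exp_ge_add_one_self[of "- v"] by (simp add: exp_minus field_simps)
  have "exp u - 1 - u \<le> u * (exp u - 1)"
    using secant[of u] by (simp add: algebra_simps)
  also have "\<dots> \<le> \<bar>u\<bar> * \<bar>exp u - 1\<bar>"
    by (metis abs_ge_self abs_mult)
  also have "\<bar>exp u - 1\<bar> \<le> \<bar>u\<bar> * exp \<bar>u\<bar>"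
  proof (cases "0 \<le> u")
    case True
    then show ?thesis using secant[of u] by simp
  next
    case False
    then have "\<bar>exp u - 1\<bar> \<le> \<bar>u\<bar> * 1"
      using lower by simp
    also have "\<dots> \<le> \<bar>u\<bar> * exp \<bar>u\<bar>"
      by (intro mult_left_mono) auto
    finally show ?thesis .
  qed
  then have "\<bar>u\<bar> * \<bar>exp u - 1\<bar> \<le> \<bar>u\<bar> * (\<bar>u\<bar> * exp \<bar>u\<bar>)"
    by (rule mult_left_mono) simp
  finally show ?thesis
    using lower by (simp add: power2_eq_square mult.assoc[symmetric] abs_mult_self_eq)
qed

text \<open>
  By the bound on \<open>exp u - 1 - u\<close>, the error of the difference quotient is at most \<open>\<bar>h\<bar>\<close> times
  the integral of \<open>t^2 \<bar>w t\<bar> exp(- (x - d) t)\<close>, which converges as soon as \<open>a < x - d\<close>.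
\<close>

lemma laplace_has_derivative:
  assumes w: "laplace_integrable a w" and "a < x"
  shows "(laplace w has_real_derivative - laplace (\<lambda>t. t * w t) x) (at x)"
proof -
  define d where "d = (x - a) / 2"
  have d: "0 < d" "a < x - d"
    using \<open>a < x\<close> by (simp_all add: d_def field_simps)
  define K where "K = (LINT t:{0<..}|lborel. \<bar>t ^ 2 * w t * exp (- ((x - d) * t))\<bar>)"
  have K_int: "set_integrable lborel {0<..} (\<lambda>t. \<bar>t ^ 2 * w t * exp (- ((x - d) * t))\<bar>)"
    using laplace_integrableD[OF laplace_integrable_power[OF w, of 2] d(2)]
    by (rule set_integrable_abs)
  have bound: "\<bar>(laplace w (x + h) - laplace w x) / h - - laplace (\<lambda>t. t * w t) x\<bar> \<le> \<bar>h\<bar> * K"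
    if h: "h \<noteq> 0" "\<bar>h\<bar> < d" for h
  proof -
    let ?r = "\<lambda>t. w t * exp (- ((x + h) * t)) - w t * exp (- (x * t)) + h * (t * w t * exp (- (x * t)))"
    have ints: "set_integrable lborel {0<..} (\<lambda>t. w t * exp (- ((x + h) * t)))"
        "set_integrable lborel {0<..} (\<lambda>t. w t * exp (- (x * t)))"
        "set_integrable lborel {0<..} (\<lambda>t. h * (t * w t * exp (- (x * t))))"
      using h d \<open>a < x\<close>
      by (auto intro!: laplace_integrableD[OF w] laplace_integrableD[OF laplace_integrable_times_t[OF w]])
    have r_int: "set_integrable lborel {0<..} ?r"
      using ints by simp
    have remainder: "laplace w (x + h) - laplace w x + h * laplace (\<lambda>t. t * w t) x
        = (LINT t:{0<..}|lborel. ?r t)"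
      using ints by (simp add: laplace_def)
    have "\<bar>LINT t:{0<..}|lborel. ?r t\<bar> \<le> (LINT t:{0<..}|lborel. \<bar>?r t\<bar>)"
      using set_integral_norm_bound[OF r_int] unfolding real_norm_def .
    also have "\<dots> \<le> (LINT t:{0<..}|lborel. h\<^sup>2 * \<bar>t ^ 2 * w t * exp (- ((x - d) * t))\<bar>)"
    proof (rule set_integral_mono)
      show "set_integrable lborel {0<..} (\<lambda>t. \<bar>?r t\<bar>)"
        using r_int by (rule set_integrable_abs)
      show "set_integrable lborel {0<..} (\<lambda>t. h\<^sup>2 * \<bar>t ^ 2 * w t * exp (- ((x - d) * t))\<bar>)"
        using K_int by simp
      fix t :: real assume "t \<in> {0<..}"
      then have t: "0 < t" by simp
      have exps: "exp (- ((x + h) * t)) = exp (- (x * t)) * exp (- (h * t))"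
          "exp (- ((x - d) * t)) = exp (- (x * t)) * exp (d * t)"
        by (simp_all add: mult_exp_exp algebra_simps)
      have factor: "v * (p * q) - v * p + h * (t * v * p) = v * p * (q - 1 - - (h * t))" for v p q :: real
        by (simp add: algebra_simps)
      have "\<bar>?r t\<bar> = \<bar>w t\<bar> * exp (- (x * t)) * \<bar>exp (- (h * t)) - 1 - - (h * t)\<bar>"
        unfolding exps(1) factor by (simp only: abs_mult abs_exp_cancel)
      also have "\<dots> \<le> \<bar>w t\<bar> * exp (- (x * t)) * ((- (h * t))\<^sup>2 * exp \<bar>- (h * t)\<bar>)"
        by (intro mult_left_mono exp_taylor1_bound) simp
      also have "exp \<bar>- (h * t)\<bar> \<le> exp (d * t)"
        using h t by (simp add: abs_mult)
      then have "\<bar>w t\<bar> * exp (- (x * t)) * ((- (h * t))\<^sup>2 * exp \<bar>- (h * t)\<bar>)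
          \<le> \<bar>w t\<bar> * exp (- (x * t)) * ((- (h * t))\<^sup>2 * exp (d * t))"
        by (intro mult_left_mono) auto
      also have "\<dots> = h\<^sup>2 * (t\<^sup>2 * \<bar>w t\<bar> * (exp (- (x * t)) * exp (d * t)))"
        by (simp add: power_mult_distrib)
      also have "\<dots> = h\<^sup>2 * \<bar>t ^ 2 * w t * exp (- ((x - d) * t))\<bar>"
        unfolding exps(2) by (simp add: abs_mult mult.assoc)
      finally show "\<bar>?r t\<bar> \<le> h\<^sup>2 * \<bar>t ^ 2 * w t * exp (- ((x - d) * t))\<bar>" .
    qed
    also have "\<dots> = h\<^sup>2 * K"
      by (simp add: K_def)
    finally have *: "\<bar>laplace w (x + h) - laplace w x + h * laplace (\<lambda>t. t * w t) x\<bar> \<le> h\<^sup>2 * K"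
      unfolding remainder .
    have "(laplace w (x + h) - laplace w x) / h - - laplace (\<lambda>t. t * w t) x
        = (laplace w (x + h) - laplace w x + h * laplace (\<lambda>t. t * w t) x) / h"
      using h by (simp add: field_simps)
    also have "\<bar>\<dots>\<bar> \<le> h\<^sup>2 * K / \<bar>h\<bar>"
      unfolding abs_divide using * by (rule divide_right_mono) simp
    also have "\<dots> = \<bar>h\<bar> * K"
      using h by (simp add: abs_if power2_eq_square)
    finally show ?thesis .
  qed
  have "((\<lambda>h. (laplace w (x + h) - laplace w x) / h - - laplace (\<lambda>t. t * w t) x) \<longlongrightarrow> 0) (at 0)"
  proof (rule Lim_null_comparison)
    show "\<forall>\<^sub>F h in at 0. norm ((laplace w (x + h) - laplace w x) / h - - laplace (\<lambda>t. t * w t) x)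
            \<le> \<bar>h\<bar> * K"
      unfolding eventually_at using bound d(1) by (intro exI[of _ d]) (auto simp: dist_real_def)
    show "((\<lambda>h. \<bar>h\<bar> * K) \<longlongrightarrow> 0) (at 0)"
      by (auto intro!: tendsto_eq_intros)
  qed
  then show ?thesis
    unfolding DERIV_def by (rule LIM_zero_cancel)
qed

lemma exp_integrable:
  assumes "0 < p" shows "set_integrable lborel {0<..} (\<lambda>t::real. exp (- (p * t)))"
proof -
  have "set_integrable lborel (einterval 0 \<infinity>) (\<lambda>t. exp (- (p * t)))"
  proof (rule interval_integral_FTC_nonneg)
    show "((\<lambda>t. - exp (- (p * t)) / p) has_real_derivative exp (- (p * t))) (at t)" for t
      using assms by (auto intro!: derivative_eq_intros)
    show "(((\<lambda>t. - exp (- (p * t)) / p) \<circ> real_of_ereal) \<longlongrightarrow> - 1 / p) (at_right 0)"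
      unfolding zero_ereal_def ereal_tendsto_simps
      using assms by (auto intro!: tendsto_eq_intros)
    show "(((\<lambda>t. - exp (- (p * t)) / p) \<circ> real_of_ereal) \<longlongrightarrow> 0) (at_left \<infinity>)"
      unfolding ereal_tendsto_simps using assms by real_asymp
  qed auto
  then show ?thesis
    by (simp add: einterval_eq zero_ereal_def)
qed

lemma bounded_on_halfline:
  fixes f :: "real \<Rightarrow> real"
  assumes cont: "continuous_on {0<..} f" and zero: "(f \<longlongrightarrow> l) (at_right 0)" and inf: "(f \<longlongrightarrow> m) at_top"
  obtains M where "\<And>t. 0 < t \<Longrightarrow> \<bar>f t\<bar> \<le> M"
proof -
  have "\<forall>\<^sub>F t in at_right 0. \<bar>f t\<bar> < \<bar>l\<bar> + 1"
    using tendsto_rabs[OF zero] by (rule order_tendstoD) simp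
  then obtain b where b: "0 < b" "\<And>t. 0 < t \<Longrightarrow> t < b \<Longrightarrow> \<bar>f t\<bar> < \<bar>l\<bar> + 1"
    unfolding eventually_at_right_field by blast
  have "\<forall>\<^sub>F t in at_top. \<bar>f t\<bar> < \<bar>m\<bar> + 1"
    using tendsto_rabs[OF inf] by (rule order_tendstoD) simp
  then obtain T where T: "\<And>t. T \<le> t \<Longrightarrow> \<bar>f t\<bar> < \<bar>m\<bar> + 1"
    unfolding eventually_at_top_linorder by blast
  have "compact (f ` {b..T})"
    using b(1) by (intro compact_continuous_image continuous_on_subset[OF cont]) auto
  then obtain B where "\<forall>y\<in>f ` {b..T}. norm y \<le> B"
    using compact_imp_bounded bounded_iff by blast
  then have B: "\<bar>f t\<bar> \<le> B" if "b \<le> t" "t \<le> T" for t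
    using that by auto
  show ?thesis
  proof (rule that)
    fix t :: real assume "0 < t"
    then show "\<bar>f t\<bar> \<le> max B (max (\<bar>l\<bar> + 1) (\<bar>m\<bar> + 1))"
      using b(2)[of t] T[of t] B[of t] by (cases "t < b"; cases "T \<le> t") (auto simp: le_max_iff_disj)
  qed
qed

lemma laplace_integrableI:
  assumes cont: "continuous_on {0<..} f" and zero: "(f \<longlongrightarrow> l) (at_right 0)"
    and inf: "((\<lambda>t. f t * exp (c * t)) \<longlongrightarrow> m) at_top"
  shows "laplace_integrable (- c) f"
  unfolding laplace_integrable_def
proof (intro allI impI)
  fix x assume "- c < x"
  obtain M where M: "\<And>t. 0 < t \<Longrightarrow> \<bar>f t * exp (c * t)\<bar> \<le> M"
  proof (rule bounded_on_halfline)
    show "continuous_on {0<..} (\<lambda>t. f t * exp (c * t))"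
      using cont by (intro continuous_intros)
    show "((\<lambda>t. f t * exp (c * t)) \<longlongrightarrow> l) (at_right 0)"
      using zero by (auto intro!: tendsto_eq_intros)
  qed (use inf in auto)
  show "set_integrable lborel {0<..} (\<lambda>t. f t * exp (- (x * t)))"
  proof (rule set_integrable_bound)
    show "set_integrable lborel {0<..} (\<lambda>t. M * exp (- ((x + c) * t)))"
      using exp_integrable[of "x + c"] \<open>- c < x\<close> by (intro set_integrable_mult_right) auto
    have "continuous_on {0<..} (\<lambda>t. f t * exp (- (x * t)))"
      using cont by (intro continuous_intros)
    then show "set_borel_measurable lborel {0<..} (\<lambda>t. f t * exp (- (x * t)))"
      unfolding set_borel_measurable_def measurable_lborel2
      by (intro borel_measurable_continuous_on_indicator) auto
    have "\<bar>f t * exp (- (x * t))\<bar> \<le> M * exp (- ((x + c) * t))" if "0 < t" for t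
    proof -
      have "\<bar>f t * exp (- (x * t))\<bar> = \<bar>f t * exp (c * t)\<bar> * exp (- ((x + c) * t))"
        unfolding abs_mult abs_exp_cancel mult.assoc mult_exp_exp by (simp add: algebra_simps)
      also have "\<dots> \<le> M * exp (- ((x + c) * t))"
        using M[OF that] by (rule mult_right_mono) simp
      finally show ?thesis .
    qed
    then show "AE t in lborel. t \<in> {0<..} \<longrightarrow> norm (f t * exp (- (x * t))) \<le> norm (M * exp (- ((x + c) * t)))"
      by (auto intro!: AE_I2 order_trans[OF _ abs_ge_self])
  qed
qed

text \<open>
  Integration by parts: \<open>f t exp(- x t)\<close> has the limits \<open>l\<close> at \<open>0\<close> and \<open>0\<close> at infinity, and
  its derivative is \<open>(f' t - x f t) exp(- x t)\<close>.
\<close>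

lemma laplace_deriv:
  assumes f: "\<And>t. 0 < t \<Longrightarrow> (f has_real_derivative f' t) (at t)"
    and f'_cont: "continuous_on {0<..} f'"
    and f_zero: "(f \<longlongrightarrow> l) (at_right 0)" and f'_zero: "(f' \<longlongrightarrow> l') (at_right 0)"
    and f_inf: "((\<lambda>t. f t * exp (c * t)) \<longlongrightarrow> m) at_top"
    and f'_inf: "((\<lambda>t. f' t * exp (c * t)) \<longlongrightarrow> m') at_top"
    and x: "- c < x"
  shows "laplace f' x = x * laplace f x - l"
proof -
  have f_cont: "continuous_on {0<..} f"
    using f by (meson DERIV_isCont continuous_at_imp_continuous_on greaterThan_iff)
  have ints: "set_integrable lborel {0<..} (\<lambda>t. f t * exp (- (x * t)))"
      "set_integrable lborel {0<..} (\<lambda>t. f' t * exp (- (x * t)))"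
    using laplace_integrableI[OF f_cont f_zero f_inf] laplace_integrableI[OF f'_cont f'_zero f'_inf] x
    by (auto simp: laplace_integrable_def)
  let ?F = "\<lambda>t. f t * exp (- (x * t))"
  let ?F' = "\<lambda>t. f' t * exp (- (x * t)) - x * (f t * exp (- (x * t)))"
  have "(LBINT t=0..\<infinity>. ?F' t) = 0 - l"
  proof (rule interval_integral_FTC_integrable)
    fix t :: real assume "0 < ereal t"
    then have t: "0 < t" by (simp add: zero_ereal_def)
    show "(?F has_vector_derivative ?F' t) (at t)"
      using f[OF t] unfolding has_real_derivative_iff_has_vector_derivative[symmetric]
      by (auto intro!: derivative_eq_intros)
    have "continuous_on {0<..} ?F'"
      using f_cont f'_cont by (intro continuous_intros)
    then show "isCont ?F' t"
      using t by (simp add: continuous_on_eq_continuous_at)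
  next
    show "set_integrable lborel (einterval 0 \<infinity>) ?F'"
      using ints by (simp add: einterval_eq zero_ereal_def)
    show "((?F \<circ> real_of_ereal) \<longlongrightarrow> l) (at_right 0)"
      unfolding zero_ereal_def ereal_tendsto_simps
      using f_zero by (auto intro!: tendsto_eq_intros)
    have "((\<lambda>t. f t * exp (c * t) * exp (- ((x + c) * t))) \<longlongrightarrow> m * 0) at_top"
    proof (rule tendsto_mult[OF f_inf])
      have "0 < x + c" using x by simp
      then show "((\<lambda>t. exp (- ((x + c) * t))) \<longlongrightarrow> 0) at_top"
        by real_asymp
    qed
    then show "((?F \<circ> real_of_ereal) \<longlongrightarrow> 0) (at_left \<infinity>)"
      unfolding ereal_tendsto_simps by (simp add: mult_exp_exp algebra_simps)
  qed auto
  moreover have "(LBINT t=0..\<infinity>. ?F' t) = (LINT t:{0<..}|lborel. ?F' t)"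
    unfolding zero_ereal_def by (rule interval_integral_to_infinity_eq)
  moreover have "\<dots> = laplace f' x - x * laplace f x"
    using ints by (simp add: laplace_def)
  ultimately show ?thesis by simp
qed

lemma laplace_tendsto_0:
  assumes "laplace_integrable a w"
  shows "(laplace w \<longlongrightarrow> 0) at_top"
proof -
  let ?s = "\<lambda>x t. indicator {0<..} t *\<^sub>R (w t * exp (- (x * t))) :: real"
  have meas: "integrable lborel (?s x)" if "a < x" for x
    using laplace_integrableD[OF assms that] by (simp add: set_integrable_def)
  have measw: "?s x \<in> borel_measurable lborel" for x
  proof -
    have "?s (a + 1) \<in> borel_measurable lborel"
      using meas[of "a + 1"] by auto
    then have "(\<lambda>t. exp ((a + 1 - x) * t) * ?s (a + 1) t) \<in> borel_measurable lborel"
      by (intro borel_measurable_times) auto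
    also have "(\<lambda>t. exp ((a + 1 - x) * t) * ?s (a + 1) t) = ?s x"
      by (auto simp: fun_eq_iff indicator_def mult_exp_exp algebra_simps)
    finally show ?thesis .
  qed
  have "((\<lambda>x. integral\<^sup>L lborel (?s x)) \<longlongrightarrow> integral\<^sup>L lborel (\<lambda>_::real. 0::real)) at_top"
  proof (rule integral_dominated_convergence_at_top)
    show "integrable lborel (\<lambda>t. norm (?s (a + 1) t))"
      using meas[of "a + 1"] by (intro integrable_norm) simp
    show "\<forall>\<^sub>F x in at_top. AE t in lborel. norm (?s x t) \<le> norm (?s (a + 1) t)"
      using eventually_ge_at_top[of "a + 1"]
      by eventually_elim (auto intro!: AE_I2 mult_left_mono simp: abs_mult indicator_def)
    show "AE t in lborel. ((\<lambda>x. ?s x t) \<longlongrightarrow> 0) at_top"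
    proof (rule AE_I2)
      fix t :: real
      show "((\<lambda>x. ?s x t) \<longlongrightarrow> 0) at_top"
      proof (cases "0 < t")
        case True
        then show ?thesis by (simp, real_asymp)
      qed simp
    qed
  qed (use measw in auto)
  then show ?thesis
    by (simp add: laplace_def[abs_def] set_lebesgue_integral_def)
qed

lemma laplace_integrable_shift:
  assumes "laplace_integrable a w"
  shows "laplace_integrable (a - c) (\<lambda>t. exp (- (c * t)) * w t)"
  unfolding laplace_integrable_def
proof (intro allI impI)
  fix x assume "a - c < x"
  then have "set_integrable lborel {0<..} (\<lambda>t. w t * exp (- ((x + c) * t)))"
    by (intro laplace_integrableD[OF assms]) simp
  moreover have eq: "exp (- (c * t)) * w t * exp (- (x * t)) = w t * exp (- ((x + c) * t))" for t
    by (simp add: mult_exp_exp algebra_simps)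
  ultimately show "set_integrable lborel {0<..} (\<lambda>t. exp (- (c * t)) * w t * exp (- (x * t)))"
    unfolding eq by simp
qed

lemma laplace_cong: "(\<And>t. 0 < t \<Longrightarrow> v t = w t) \<Longrightarrow> laplace v x = laplace w x"
  unfolding laplace_def by (intro set_lebesgue_integral_cong) auto

lemma laplace_shift: "laplace (\<lambda>t. exp (- (c * t)) * w t) x = laplace w (x + c)"
  by (simp add: laplace_def mult_exp_exp algebra_simps)

lemma laplace_1:
  assumes "0 < x"
  shows "laplace (\<lambda>t. 1) x = 1 / x"
  using laplace_deriv[of "\<lambda>t. 1" "\<lambda>t. 0" 1 0 0 1 0 x] assms
  by (simp add: laplace_def field_simps)

lemma laplace_id:
  assumes "0 < x"
  shows "laplace (\<lambda>t. t) x = 1 / x\<^sup>2"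
proof -
  have i: "laplace_integrable 0 (\<lambda>t. 1)"
    using exp_integrable by (simp add: laplace_integrable_def)
  have "(laplace (\<lambda>t. 1) has_real_derivative - laplace (\<lambda>t. t) x) (at x)"
    using laplace_has_derivative[OF i assms] by simp
  moreover have "(laplace (\<lambda>t. 1) has_real_derivative - (1 / x\<^sup>2)) (at x)"
  proof (rule DERIV_cong_ev[THEN iffD2, OF refl _ refl])
    show "\<forall>\<^sub>F y in nhds x. laplace (\<lambda>t. 1) y = 1 / y"
      using eventually_nhds_in_open[of "{0<..}" x] assms
      by (auto elim!: eventually_mono simp: laplace_1)
    show "((\<lambda>y. 1 / y) has_real_derivative - (1 / x\<^sup>2)) (at x)"
      using assms by (auto intro!: derivative_eq_intros simp: power2_eq_square)
  qed
  ultimately show ?thesis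
    using DERIV_unique by fastforce
qed

section \<open>Laplace transforms of nonnegative functions as logarithms\<close>

text \<open>
  Counting derivatives by recursion, instead of through iterated derivative functions, makes
  closure under products and under \<open>exp\<close> a direct induction on \<open>n\<close>.
\<close>

primrec n_times_differentiable_on :: "nat \<Rightarrow> (real \<Rightarrow> real) \<Rightarrow> real set \<Rightarrow> bool" where
  "n_times_differentiable_on 0 f I \<longleftrightarrow> True"
| "n_times_differentiable_on (Suc n) f I \<longleftrightarrow>
     (\<exists>f'. (\<forall>x\<in>I. (f has_real_derivative f' x) (at x)) \<and> n_times_differentiable_on n f' I)"

lemma has_derivative_cong_open:
  assumes "open I" "x \<in> I" "\<And>y. y \<in> I \<Longrightarrow> f y = g y" "(f has_real_derivative d) (at x)"
  shows "(g has_real_derivative d) (at x)"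
  using has_field_derivative_transform_within_open[OF assms(4,1,2,3)] .

lemma n_times_differentiable_on_cong:
  assumes "open I" "\<And>x. x \<in> I \<Longrightarrow> f x = g x" "n_times_differentiable_on n f I"
  shows "n_times_differentiable_on n g I"
proof (cases n)
  case (Suc m)
  from assms(3) obtain f' where
    f': "\<forall>x\<in>I. (f has_real_derivative f' x) (at x)" "n_times_differentiable_on m f' I"
    unfolding Suc by auto
  have "\<forall>x\<in>I. (g has_real_derivative f' x) (at x)"
    using f'(1) assms(1,2) has_derivative_cong_open[of I _ f g] by blast
  with f'(2) show ?thesis
    unfolding Suc by auto
qed simp

lemma n_times_differentiable_on_pred:
  "n_times_differentiable_on (Suc n) f I \<Longrightarrow> n_times_differentiable_on n f I"
proof (induction n arbitrary: f)
  case (Suc n)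
  then show ?case
    by (metis n_times_differentiable_on.simps(2))
qed simp

lemma n_times_differentiable_on_add:
  "n_times_differentiable_on n f I \<Longrightarrow> n_times_differentiable_on n g I \<Longrightarrow>
    n_times_differentiable_on n (\<lambda>x. f x + g x) I"
proof (induction n arbitrary: f g)
  case (Suc n)
  then obtain f' g' where
    "\<forall>x\<in>I. (f has_real_derivative f' x) (at x)" "n_times_differentiable_on n f' I"
    "\<forall>x\<in>I. (g has_real_derivative g' x) (at x)" "n_times_differentiable_on n g' I"
    by auto
  with Suc.IH[of f' g'] show ?case
    by (auto intro!: exI[of _ "\<lambda>x. f' x + g' x"] DERIV_add)
qed simp

lemma n_times_differentiable_on_mult:
  "n_times_differentiable_on n f I \<Longrightarrow> n_times_differentiable_on n g I \<Longrightarrow>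
    n_times_differentiable_on n (\<lambda>x. f x * g x) I"
proof (induction n arbitrary: f g)
  case (Suc n)
  then obtain f' g' where
    f': "\<forall>x\<in>I. (f has_real_derivative f' x) (at x)" "n_times_differentiable_on n f' I" and
    g': "\<forall>x\<in>I. (g has_real_derivative g' x) (at x)" "n_times_differentiable_on n g' I"
    by auto
  have "n_times_differentiable_on n (\<lambda>x. f' x * g x + g' x * f x) I"
    using f'(2) g'(2) Suc.prems[THEN n_times_differentiable_on_pred]
    by (intro n_times_differentiable_on_add Suc.IH)
  moreover have "\<forall>x\<in>I. ((\<lambda>x. f x * g x) has_real_derivative f' x * g x + g' x * f x) (at x)"
    using f' g' by (auto intro!: DERIV_mult)
  ultimately show ?case by auto
qed simp

lemma n_times_differentiable_on_exp:
  "n_times_differentiable_on n f I \<Longrightarrow> n_times_differentiable_on n (\<lambda>x. exp (f x)) I"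
proof (induction n arbitrary: f)
  case (Suc n)
  then obtain f' where
    f': "\<forall>x\<in>I. (f has_real_derivative f' x) (at x)" "n_times_differentiable_on n f' I"
    by auto
  have "n_times_differentiable_on n (\<lambda>x. exp (f x) * f' x) I"
    using f'(2) n_times_differentiable_on_pred[OF Suc.prems]
    by (intro n_times_differentiable_on_mult Suc.IH)
  moreover have "\<forall>x\<in>I. ((\<lambda>x. exp (f x)) has_real_derivative exp (f x) * f' x) (at x)"
    using f' by (auto intro!: DERIV_fun_exp)
  ultimately show ?case by auto
qed simp

lemma n_times_differentiable_on_const: "n_times_differentiable_on n (\<lambda>x. c) I"
proof (induction n arbitrary: c)
  case (Suc n)
  then show ?case
    by (auto intro!: exI[of _ "\<lambda>_. 0"])
qed simp

lemma n_times_differentiable_on_laplace: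
  "laplace_integrable a w \<Longrightarrow> n_times_differentiable_on n (laplace w) {a<..}"
proof (induction n arbitrary: w)
  case (Suc n)
  have "laplace_integrable a (\<lambda>t. - 1 * (t * w t))"
    using Suc.prems by (intro laplace_integrable_cmult laplace_integrable_times_t)
  then have "n_times_differentiable_on n (laplace (\<lambda>t. - 1 * (t * w t))) {a<..}"
    by (rule Suc.IH)
  moreover have "\<forall>x\<in>{a<..}. (laplace w has_real_derivative laplace (\<lambda>t. - 1 * (t * w t)) x) (at x)"
    using laplace_has_derivative[OF Suc.prems] unfolding laplace_cmult by simp
  ultimately show ?case by auto
qed simp

lemma vector_derivative_within_open_real:
  assumes "open I" "x \<in> I" "(f has_real_derivative d) (at x)"
  shows "vector_derivative f (at x within I) = d"
  using assms(3) unfolding at_within_open[OF assms(2,1)] has_real_derivative_iff_has_vector_derivative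
  by (rule vector_derivative_at)

lemma has_derivs_of_all_orders_onI:
  assumes "open I" "\<And>n. n_times_differentiable_on n f I"
  shows "has_derivs_of_all_orders_on f I"
proof -
  have all: "n_times_differentiable_on n (nth_deriv_on I k f) I" for k n
  proof (induction k arbitrary: n)
    case (Suc k)
    from Suc.IH[of "Suc n"] obtain g where
      g: "\<forall>x\<in>I. (nth_deriv_on I k f has_real_derivative g x) (at x)" "n_times_differentiable_on n g I"
      by auto
    have "vector_derivative (nth_deriv_on I k f) (at x within I) = g x" if "x \<in> I" for x
      using g(1) that vector_derivative_within_open_real[OF assms(1)] by blast
    then show ?case
      using n_times_differentiable_on_cong[OF assms(1) _ g(2)] by simp
  next
    case 0
    then show ?case
      using assms(2) by simp
  qed
  have *: "\<exists>g. \<forall>x\<in>I. (nth_deriv_on I k f has_real_derivative g x) (at x)" for k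
    using all[where n = "Suc 0" and k = k] by simp
  show ?thesis
    unfolding has_derivs_of_all_orders_on_def differentiable_on_def real_differentiable_def
  proof (intro allI ballI)
    fix k x assume "x \<in> I"
    moreover obtain g where "\<forall>x\<in>I. (nth_deriv_on I k f has_real_derivative g x) (at x)"
      using *[of k] by (rule exE)
    ultimately have "(nth_deriv_on I k f has_real_derivative g x) (at x within I)"
      by (simp add: has_field_derivative_at_within)
    then show "\<exists>D. (nth_deriv_on I k f has_real_derivative D) (at x within I)"
      by (rule exI)
  qed
qed

lemma nth_deriv_on_eqI:
  assumes "open I" "\<And>x. x \<in> I \<Longrightarrow> f x = D 0 x"
    "\<And>k x. x \<in> I \<Longrightarrow> (D k has_real_derivative D (Suc k) x) (at x)"
  shows "x \<in> I \<Longrightarrow> nth_deriv_on I k f x = D k x"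
proof (induction k arbitrary: x)
  case (Suc k)
  have "(nth_deriv_on I k f has_real_derivative D (Suc k) x) (at x)"
    by (rule has_derivative_cong_open[OF assms(1) Suc.prems _ assms(3)[OF Suc.prems]])
       (simp add: Suc.IH)
  then show ?case
    using vector_derivative_within_open_real[OF assms(1) Suc.prems] by simp
next
  case 0
  then show ?case
    using assms(2) by simp
qed

text \<open>
  The \<open>k\<close>-th derivative of \<open>laplace w\<close> is \<open>(-1)^k\<close> times the transform of the nonnegative
  function \<open>t^k w t\<close>. The constant \<open>C\<close> only affects the derivative of order \<open>0\<close>.
\<close>

theorem log_completely_monotonic_on_exp_laplace:
  assumes w: "laplace_integrable a w" "\<And>t. 0 < t \<Longrightarrow> 0 \<le> w t"
    and f: "\<And>x. a < x \<Longrightarrow> f x = exp (C + laplace w x)"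
  shows "log_completely_monotonic_on f {a<..}"
  unfolding log_completely_monotonic_on_def
proof (intro conjI allI impI ballI)
  show "is_interval {a<..}"
    by (rule is_interval_oi)
  show "interior {a<..} \<noteq> {}"
    by (simp add: interior_open)
  show "0 < f x" if "x \<in> {a<..}" for x
    using f that by simp
  show "has_derivs_of_all_orders_on f {a<..}"
  proof (rule has_derivs_of_all_orders_onI)
    fix n
    have "n_times_differentiable_on n (\<lambda>x. exp (C + laplace w x)) {a<..}"
      by (intro n_times_differentiable_on_exp n_times_differentiable_on_add
          n_times_differentiable_on_const n_times_differentiable_on_laplace w)
    then show "n_times_differentiable_on n f {a<..}"
      by (rule n_times_differentiable_on_cong[rotated 2]) (simp_all add: f)
  qed simp
  fix k :: nat and x :: real
  assume k: "1 \<le> k" and x: "x \<in> {a<..}"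
  define D where "D = (\<lambda>k x. (if k = 0 then C else 0) + (-1) ^ k * laplace (\<lambda>t. t ^ k * w t) x)"
  have "nth_deriv_on {a<..} k (\<lambda>t. ln (f t)) x = D k x"
  proof (rule nth_deriv_on_eqI)
    show "ln (f x) = D 0 x" if "x \<in> {a<..}" for x
      using that by (simp add: f D_def)
    fix k and x :: real assume "x \<in> {a<..}"
    then have "(laplace (\<lambda>t. t ^ k * w t) has_real_derivative
        - laplace (\<lambda>t. t * (t ^ k * w t)) x) (at x)"
      using laplace_has_derivative[OF laplace_integrable_power[OF w(1)]] by simp
    from DERIV_add[OF DERIV_const DERIV_cmult[OF this]]
    show "(D k has_real_derivative D (Suc k) x) (at x)"
      unfolding D_def by (simp add: mult.assoc)
  qed (use x in auto)
  then have "(-1) ^ k * nth_deriv_on {a<..} k (\<lambda>t. ln (f t)) x = laplace (\<lambda>t. t ^ k * w t) x"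
    using k by (cases "even k") (simp_all add: D_def)
  also have "0 \<le> \<dots>"
    using w(2) by (intro laplace_nonneg) simp
  finally show "0 \<le> (-1) ^ k * nth_deriv_on {a<..} k (\<lambda>t. ln (f t)) x" .
qed

section \<open>The remainder in Burnside's formula as a Laplace transform\<close>

definition burnside_remainder :: "real \<Rightarrow> real" where
  "burnside_remainder x = ln (sqrt (2 * pi)) + (x + 1/2) * (ln (x + 1/2) - 1) - ln_Gamma (x + 1)"

lemma continuous_on_kernel:
  "continuous_on {0<..} kernel" "continuous_on {0<..} kernel'"
  "continuous_on {0<..} kernel''" "continuous_on {0<..} kernel'''"
proof -
  have "continuous_on {0<..} bose"
    unfolding bose_def[abs_def] by (intro continuous_intros) auto
  then show "continuous_on {0<..} kernel" "continuous_on {0<..} kernel'"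
      "continuous_on {0<..} kernel''" "continuous_on {0<..} kernel'''"
    unfolding kernel_def[abs_def] kernel'_def[abs_def] kernel''_def[abs_def] kernel'''_def[abs_def]
    by (auto intro!: continuous_intros)
qed

lemma laplace_integrable_kernel:
  "laplace_integrable (- 1/2) kernel" "laplace_integrable (- 1/2) kernel'"
  "laplace_integrable (- 1/2) kernel''" "laplace_integrable (- 1/2) kernel'''"
  using laplace_integrableI[OF continuous_on_kernel(1) kernel_at_0 kernel_at_top]
    laplace_integrableI[OF continuous_on_kernel(2) kernel'_at_0 kernel'_at_top]
    laplace_integrableI[OF continuous_on_kernel(3) kernel''_at_0 kernel''_at_top]
    laplace_integrableI[OF continuous_on_kernel(4) kernel'''_at_0 kernel'''_at_top]
  by simp_all

lemma laplace_kernel': "- 1/2 < x \<Longrightarrow> laplace kernel' x = x * laplace kernel x - 1/24"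
  using laplace_deriv[OF kernel_has_derivative continuous_on_kernel(2)
    kernel_at_0 kernel'_at_0 kernel_at_top kernel'_at_top, of x]
  by simp

lemma laplace_kernel'': "- 1/2 < x \<Longrightarrow> laplace kernel'' x = x * laplace kernel' x + 1/48"
  using laplace_deriv[OF kernel'_has_derivative continuous_on_kernel(3)
    kernel'_at_0 kernel''_at_0 kernel'_at_top kernel''_at_top, of x]
  by simp

lemma laplace_kernel''': "- 1/2 < x \<Longrightarrow> laplace kernel''' x = x * laplace kernel'' x - 23/2880"
  using laplace_deriv[OF kernel''_has_derivative continuous_on_kernel(4)
    kernel''_at_0 kernel'''_at_0 kernel''_at_top kernel'''_at_top, of x]
  by simp

text \<open>
  The shift \<open>x \<mapsto> x + 1\<close> multiplies the weight by \<open>exp(- t)\<close>. The factor \<open>1 - exp(- t)\<close> of the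
  difference cancels the denominator of \<open>bose\<close>, and \<open>t^2\<close> the poles, so that only elementary
  transforms remain.
\<close>

lemma laplace_kernel_second_deriv_difference:
  assumes x: "- 1/2 < x"
  shows "laplace (\<lambda>t. t * (t * kernel t)) x - laplace (\<lambda>t. t * (t * kernel t)) (x + 1)
    = 1 / (x + 1/2) - 1 / (x + 3/2) - 1 / (x + 1)\<^sup>2"
proof -
  let ?w = "\<lambda>t. t * (t * kernel t)"
  have w: "laplace_integrable (- 1/2) ?w"
    by (intro laplace_integrable_times_t laplace_integrable_kernel)
  have w1: "laplace_integrable (- 1/2) (\<lambda>t. exp (- (1 * t)) * ?w t)"
    by (rule laplace_integrable_mono[OF laplace_integrable_shift[OF w]]) simp
  have one: "laplace_integrable 0 (\<lambda>t. 1)"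
    using exp_integrable by (simp add: laplace_integrable_def)
  have e: "laplace_integrable (- 1/2) (\<lambda>t. exp (- (1/2 * t)) * 1)"
      "laplace_integrable (- 1/2) (\<lambda>t. exp (- (3/2 * t)) * 1)"
      "laplace_integrable (- 1/2) (\<lambda>t. exp (- (1 * t)) * (t * 1))"
    by (rule laplace_integrable_mono[OF laplace_integrable_shift] one laplace_integrable_times_t | simp)+
  have "laplace ?w x - laplace ?w (x + 1) = laplace (\<lambda>t. ?w t + - 1 * (exp (- (1 * t)) * ?w t)) x"
    unfolding laplace_add[OF w laplace_integrable_cmult[OF w1] x] laplace_cmult laplace_shift by simp
  also have "\<dots> = laplace (\<lambda>t. exp (- (1/2 * t)) * 1
      + (- 1 * (exp (- (3/2 * t)) * 1) + - 1 * (exp (- (1 * t)) * (t * 1)))) x"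
  proof (rule laplace_cong)
    fix t :: real assume t: "0 < t"
    have "exp t - 1 \<noteq> 0"
      using t by simp
    then have b: "bose t * (1 - exp (- t)) = exp (- t)"
      by (simp add: bose_def exp_minus field_simps)
    have e: "exp (- (1 / 2 * t)) * (1 - exp (- t)) = exp (- (1 / 2 * t)) - exp (- (3/2 * t))"
      by (simp add: right_diff_distrib mult_exp_exp)
    have "?w t = exp (- (1 / 2 * t)) - t * bose t"
      using t by (simp add: kernel_def field_simps power2_eq_square)
    then have "?w t * (1 - exp (- t)) = exp (- (1 / 2 * t)) * (1 - exp (- t)) - t * (bose t * (1 - exp (- t)))"
      by (simp add: left_diff_distrib)
    also have "\<dots> = exp (- (1 / 2 * t)) - exp (- (3/2 * t)) - t * exp (- t)"
      unfolding b e ..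
    finally have "?w t * (1 - exp (- t)) = exp (- (1 / 2 * t)) - exp (- (3/2 * t)) - t * exp (- t)" .
    moreover have "?w t + - 1 * (exp (- (1 * t)) * ?w t) = ?w t * (1 - exp (- t))"
      by (simp add: algebra_simps)
    ultimately show "?w t + - 1 * (exp (- (1 * t)) * ?w t) = exp (- (1/2 * t)) * 1
      + (- 1 * (exp (- (3/2 * t)) * 1) + - 1 * (exp (- (1 * t)) * (t * 1)))"
      by simp
  qed
  also have "\<dots> = laplace (\<lambda>t. 1) (x + 1/2) - laplace (\<lambda>t. 1) (x + 3/2) - laplace (\<lambda>t. t) (x + 1)"
    unfolding laplace_add[OF e(1) laplace_integrable_add[OF laplace_integrable_cmult[OF e(2)]
          laplace_integrable_cmult[OF e(3)]] x]
      laplace_add[OF laplace_integrable_cmult[OF e(2)] laplace_integrable_cmult[OF e(3)] x]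
      laplace_cmult laplace_shift
    by simp
  finally show ?thesis
    using x by (simp add: laplace_1 laplace_id)
qed

lemma Polygamma_1_tendsto_0:
  assumes "(0::real) < z"
  shows "(\<lambda>n. Polygamma 1 (z + real n)) \<longlonglongrightarrow> 0"
proof -
  have "(\<lambda>k. 1 / (z + real k)\<^sup>2) sums Polygamma 1 z"
    using Polygamma_LIMSEQ[of z 1] assms by (simp add: inverse_eq_divide power2_eq_square)
  then have "(\<lambda>n. Polygamma 1 z - (\<Sum>k<n. 1 / (z + real k)\<^sup>2)) \<longlonglongrightarrow> Polygamma 1 z - Polygamma 1 z"
    unfolding sums_def by (intro tendsto_diff tendsto_const)
  moreover have "Polygamma 1 (z + real n) = Polygamma 1 z - (\<Sum>k<n. 1 / (z + real k)\<^sup>2)" for n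
    using assms by (subst Polygamma_plus_of_nat) (auto simp: power2_eq_square)
  ultimately show ?thesis
    by simp
qed

text \<open>
  The left-hand side is the second derivative of \<open>burnside_remainder\<close>. Both sides have the
  same difference under \<open>x \<mapsto> x + 1\<close>, by the recurrence for the trigamma function on the left,
  and both tend to \<open>0\<close> along \<open>x + n\<close>.
\<close>

lemma burnside_remainder_second_deriv:
  assumes x: "- 1/2 < x"
  shows "1 / (x + 1/2) - Polygamma 1 (x + 1) = laplace (\<lambda>t. t * (t * kernel t)) x"
proof -
  define E where "E = (\<lambda>x. 1 / (x + 1/2) - Polygamma 1 (x + 1) - laplace (\<lambda>t. t * (t * kernel t)) x)"
  have per: "E (y + 1) = E y" if "- 1/2 < y" for y
  proof -
    have "Polygamma 1 (y + 1 + 1) = Polygamma 1 (y + 1) - 1 / (y + 1)\<^sup>2"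
      using that by (subst Polygamma_plus1) (simp_all add: power2_eq_square)
    then show ?thesis
      using laplace_kernel_second_deriv_difference[OF that] by (simp add: E_def add.assoc)
  qed
  have "E (x + real n) = E x" for n
  proof (induction n)
    case (Suc n)
    then show ?case
      using per[of "x + real n"] x by (simp add: add_ac)
  qed simp
  moreover have "(\<lambda>n. E (x + real n)) \<longlonglongrightarrow> 0 - 0 - 0"
    unfolding E_def
  proof (intro tendsto_diff)
    show "(\<lambda>n. 1 / (x + real n + 1/2)) \<longlonglongrightarrow> 0"
      by real_asymp
    have "(\<lambda>n. Polygamma 1 (x + 1 + real n)) \<longlonglongrightarrow> 0"
      using x by (intro Polygamma_1_tendsto_0) simp
    then show "(\<lambda>n. Polygamma 1 (x + real n + 1)) \<longlonglongrightarrow> 0"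
      by (simp add: add_ac)
    have "laplace_integrable (- 1/2) (\<lambda>t. t * (t * kernel t))"
      by (intro laplace_integrable_times_t laplace_integrable_kernel)
    moreover have "filterlim (\<lambda>n. x + real n) at_top sequentially"
      by real_asymp
    ultimately show "(\<lambda>n. laplace (\<lambda>t. t * (t * kernel t)) (x + real n)) \<longlonglongrightarrow> 0"
      using filterlim_compose laplace_tendsto_0 by blast
  qed
  ultimately have "E x = 0"
    using LIMSEQ_unique[OF _ tendsto_const] by fastforce
  then show ?thesis
    by (simp add: E_def)
qed

lemma burnside_remainder_has_derivative:
  assumes "- 1/2 < x"
  shows "(burnside_remainder has_real_derivative ln (x + 1/2) - Digamma (x + 1)) (at x)"
proof -
  have entropy: "((\<lambda>u. u * (ln u - 1)) has_real_derivative ln u) (at u)" if "0 < u" for u :: real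
    using that by (auto intro!: derivative_eq_intros)
  have "((\<lambda>x. (x + 1/2) * (ln (x + 1/2) - 1)) has_real_derivative ln (x + 1/2) * 1) (at x)"
    using assms by (intro DERIV_chain2[OF entropy]) (auto intro!: derivative_eq_intros)
  moreover have "((\<lambda>x. ln_Gamma (x + 1)) has_real_derivative Digamma (x + 1)) (at x)"
    using assms by (auto intro!: derivative_eq_intros)
  ultimately have "((\<lambda>x. ln (sqrt (2 * pi)) + (x + 1/2) * (ln (x + 1/2) - 1) - ln_Gamma (x + 1))
      has_real_derivative 0 + ln (x + 1/2) * 1 - Digamma (x + 1)) (at x)"
    by (intro DERIV_diff DERIV_add DERIV_const)
  then show ?thesis
    by (simp add: burnside_remainder_def[abs_def])
qed

lemma burnside_remainder_affine:
  "\<exists>a b. \<forall>x>-1/2. burnside_remainder x = laplace kernel x + (a * x + b)"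
proof -
  \<comment> \<open>The first derivative of \<open>burnside_remainder - laplace kernel\<close>.\<close>
  define G where "G = (\<lambda>x. ln (x + 1/2) - Digamma (x + 1) + laplace (\<lambda>t. t * kernel t) x)"
  let ?I = "{- 1/2<..} :: real set"
  have "(G has_real_derivative 0) (at x within ?I)" if "x \<in> ?I" for x
  proof -
    have x: "- 1/2 < x" using that by simp
    have "((\<lambda>x. ln (x + 1/2) - Digamma (x + 1)) has_real_derivative
        1 / (x + 1/2) - Polygamma 1 (x + 1)) (at x)"
      using x by (auto intro!: derivative_eq_intros simp: nonpos_Ints_def)
    from DERIV_add[OF this laplace_has_derivative[OF laplace_integrable_times_t[OF laplace_integrable_kernel(1)] x]]
    show ?thesis
      unfolding G_def burnside_remainder_second_deriv[OF x] by (simp add: has_field_derivative_at_within)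
  qed
  then obtain a where a: "\<And>x. x \<in> ?I \<Longrightarrow> G x = a"
    using has_field_derivative_zero_constant[of ?I G] by auto
  define H where "H = (\<lambda>x. burnside_remainder x - laplace kernel x - a * x)"
  have "(H has_real_derivative 0) (at x within ?I)" if "x \<in> ?I" for x
  proof -
    have x: "- 1/2 < x" using that by simp
    have "(H has_real_derivative ln (x + 1/2) - Digamma (x + 1) - - laplace (\<lambda>t. t * kernel t) x - a) (at x)"
      unfolding H_def using x
      by (intro DERIV_diff burnside_remainder_has_derivative laplace_has_derivative[OF laplace_integrable_kernel(1)])
         (auto intro!: derivative_eq_intros)
    then show ?thesis
      using a[OF that] by (simp add: G_def has_field_derivative_at_within)
  qed
  then obtain b where "\<And>x. x \<in> ?I \<Longrightarrow> H x = b"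
    using has_field_derivative_zero_constant[of ?I H] by auto
  then show ?thesis
    by (intro exI[of _ a] exI[of _ b]) (force simp: H_def)
qed

text \<open>
  It remains to determine the affine function \<open>a x + b\<close>. The functional equation
  \<open>\<Gamma>(x + 2) = (x + 1) \<Gamma>(x + 1)\<close> expresses \<open>a\<close>, and Legendre's duplication formula \<open>b + b - b\<close>,
  by elementary functions and values of \<open>laplace kernel\<close>, all of which tend to \<open>0\<close> as \<open>x\<close>
  grows.
\<close>

theorem burnside_remainder_laplace:
  assumes "- 1/2 < x"
  shows "burnside_remainder x = laplace kernel x"
proof -
  obtain a b where ab: "\<And>x. - 1/2 < x \<Longrightarrow> burnside_remainder x = laplace kernel x + (a * x + b)"
    using burnside_remainder_affine by blast
  note lim = laplace_tendsto_0[OF laplace_integrable_kernel(1)]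
  have large: "\<forall>\<^sub>F x in at_top. (0::real) < x"
    by (rule eventually_gt_at_top)
  have lim1: "((\<lambda>x. laplace kernel (x + 1)) \<longlongrightarrow> 0) at_top"
    by (rule filterlim_compose[OF lim]) real_asymp
  have lim2: "((\<lambda>x. laplace kernel (x + 1/2)) \<longlongrightarrow> 0) at_top"
    by (rule filterlim_compose[OF lim]) real_asymp
  have lim3: "((\<lambda>x. laplace kernel (2 * x + 1)) \<longlongrightarrow> 0) at_top"
    by (rule filterlim_compose[OF lim]) real_asymp
  have "a = 0"
  proof -
    let ?d = "\<lambda>x::real. (x + 3/2) * (ln (x + 3/2) - 1) - (x + 1/2) * (ln (x + 1/2) - 1) - ln (x + 1)"
    have "?d x - laplace kernel (x + 1) + laplace kernel x = a" if "0 < x" for x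
    proof -
      have nonpos: "x + 1 \<notin> \<int>\<^sub>\<le>\<^sub>0"
        using that by (auto simp: nonpos_Ints_def)
      then have "Gamma (x + 2) = (x + 1) * Gamma (x + 1)"
        using Gamma_plus1[of "x + 1"] by (simp add: add.assoc)
      then have "ln_Gamma (x + 2) = ln_Gamma (x + 1) + ln (x + 1)"
        using that nonpos by (simp add: ln_Gamma_real_pos ln_mult Gamma_eq_zero_iff)
      then have "burnside_remainder (x + 1) - burnside_remainder x = ?d x"
        by (simp add: burnside_remainder_def add_ac)
      then show ?thesis
        using ab[of x] ab[of "x + 1"] that by (simp add: algebra_simps)
    qed
    then have ev: "\<forall>\<^sub>F x in at_top. ?d x - laplace kernel (x + 1) + laplace kernel x = a"
      by (rule eventually_mono[OF large])
    have "(?d \<longlongrightarrow> 0) at_top"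
      by real_asymp
    then have "((\<lambda>x. ?d x - laplace kernel (x + 1) + laplace kernel x) \<longlongrightarrow> 0 - 0 + 0) at_top"
      by (intro tendsto_add tendsto_diff lim lim1)
    then have "((\<lambda>_. a) \<longlongrightarrow> 0) (at_top :: real filter)"
      using tendsto_cong[OF ev] by simp
    then show ?thesis
      by (simp add: tendsto_const_iff)
  qed
  have "b = 0"
  proof -
    \<comment> \<open>The duplication formula at \<open>x + 1\<close> involves \<open>\<Gamma>(x + 1)\<close>, \<open>\<Gamma>(x + 3/2)\<close> and \<open>\<Gamma>(2 x + 2)\<close>, hence
        the remainder at \<open>x\<close>, \<open>x + 1/2\<close> and \<open>2 x + 1\<close>.\<close>
    let ?d = "\<lambda>x::real. ln (sqrt (2 * pi)) + (x + 1/2) * (ln (x + 1/2) - 1) + (x + 1) * (ln (x + 1) - 1)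
      - (2 * x + 3/2) * (ln (2 * x + 3/2) - 1) + (2 * x + 1) * ln 2 - ln (sqrt pi)"
    have "?d x - laplace kernel x - laplace kernel (x + 1/2) + laplace kernel (2 * x + 1) = b" if "0 < x" for x
    proof -
      have "x + 1 \<notin> \<int>\<^sub>\<le>\<^sub>0" "x + 3/2 \<notin> \<int>\<^sub>\<le>\<^sub>0"
        using that by (auto simp: nonpos_Ints_def)
      then have "complex_of_real (x + 1) \<notin> \<int>\<^sub>\<le>\<^sub>0" "complex_of_real (x + 3/2) \<notin> \<int>\<^sub>\<le>\<^sub>0"
        by (simp_all only: of_real_in_nonpos_Ints_iff not_False_eq_True)
      then have "Gamma (complex_of_real (x + 1)) * Gamma (complex_of_real (x + 1) + 1/2) =
          exp ((1 - 2 * complex_of_real (x + 1)) * of_real (ln 2)) * of_real (sqrt pi)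
          * Gamma (2 * complex_of_real (x + 1))"
        by (intro Gamma_legendre_duplication) (simp_all add: add_ac)
      also have "complex_of_real (x + 1) + 1/2 = of_real (x + 3/2)"
        by simp
      also have "(1 - 2 * complex_of_real (x + 1)) * of_real (ln 2) = of_real ((1 - 2 * (x + 1)) * ln 2)"
        by simp
      also have "2 * complex_of_real (x + 1) = of_real (2 * x + 2)"
        by simp
      finally have "complex_of_real (Gamma (x + 1) * Gamma (x + 3/2)) =
          of_real (exp ((1 - 2 * (x + 1)) * ln 2) * sqrt pi * Gamma (2 * x + 2))"
        by (simp only: of_real_mult[symmetric] Gamma_complex_of_real exp_of_real)
      then have "Gamma (x + 1) * Gamma (x + 3/2) = exp ((1 - 2 * (x + 1)) * ln 2) * sqrt pi * Gamma (2 * x + 2)"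
        by (simp only: of_real_eq_iff)
      moreover have "0 < Gamma (x + 1)" "0 < Gamma (x + 3/2)" "0 < Gamma (2 * x + 2)"
        using that by simp_all
      ultimately have "ln (Gamma (x + 1)) + ln (Gamma (x + 3/2))
          = (1 - 2 * (x + 1)) * ln 2 + ln (sqrt pi) + ln (Gamma (2 * x + 2))"
        by (metis exp_gt_zero ln_exp ln_mult_pos mult_pos_pos pi_gt_zero real_sqrt_gt_zero)
      then have "ln_Gamma (x + 1) + ln_Gamma (x + 3/2) = (1 - 2 * (x + 1)) * ln 2 + ln (sqrt pi) + ln_Gamma (2 * x + 2)"
        using that by (simp add: ln_Gamma_real_pos)
      then have "burnside_remainder x + burnside_remainder (x + 1/2) - burnside_remainder (2 * x + 1) = ?d x"
        by (simp add: burnside_remainder_def add_ac) (simp add: algebra_simps)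
      then show ?thesis
        using ab[of x] ab[of "x + 1/2"] ab[of "2 * x + 1"] that by (simp add: \<open>a = 0\<close>)
    qed
    then have ev: "\<forall>\<^sub>F x in at_top. ?d x - laplace kernel x - laplace kernel (x + 1/2) + laplace kernel (2 * x + 1) = b"
      by (rule eventually_mono[OF large])
    have "(?d \<longlongrightarrow> 0) at_top"
    proof -
      \<comment> \<open>Here the constant \<open>sqrt (2 * pi)\<close> of Burnside's formula meets the \<open>sqrt pi\<close> of the duplication formula.\<close>
      have "ln (sqrt (2 * pi)) = ln 2 / 2 + ln (sqrt pi)"
        by (simp add: real_sqrt_mult ln_mult ln_sqrt)
      then have "?d = (\<lambda>x::real. ln 2 / 2 + (x + 1/2) * (ln (x + 1/2) - 1) + (x + 1) * (ln (x + 1) - 1)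
        - (2 * x + 3/2) * (ln (2 * x + 3/2) - 1) + (2 * x + 1) * ln 2)"
        by (simp add: fun_eq_iff)
      then show ?thesis
        by ((simp only:), real_asymp, simp add: field_simps)
    qed
    then have "((\<lambda>x. ?d x - laplace kernel x - laplace kernel (x + 1/2) + laplace kernel (2 * x + 1))
        \<longlongrightarrow> 0 - 0 - 0 + 0) at_top"
      by (intro tendsto_add tendsto_diff lim lim2 lim3)
    then have "((\<lambda>_. b) \<longlongrightarrow> 0) (at_top :: real filter)"
      using tendsto_cong[OF ev] by simp
    then show ?thesis
      by (simp add: tendsto_const_iff)
  qed
  show ?thesis
    using ab[OF assms] \<open>a = 0\<close> \<open>b = 0\<close> by simp
qed

section \<open>The eight functions\<close>

lemma burnside_quotient:
  assumes "- 1/2 < x"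
  shows "sqrt (2 * pi) / Gamma (x + 1) * ((x + 1/2) / exp 1) powr (x + 1/2) = exp (laplace kernel x)"
    and "Gamma (x + 1) / sqrt (2 * pi) * (exp 1 / (x + 1/2)) powr (x + 1/2) = exp (- laplace kernel x)"
proof -
  have z: "0 < x + 1/2" and x: "0 < x + 1"
    using assms by simp_all
  have powr: "((x + 1/2) / exp 1) powr (x + 1/2) = exp ((x + 1/2) * (ln (x + 1/2) - 1))"
      "(exp 1 / (x + 1/2)) powr (x + 1/2) = exp (- ((x + 1/2) * (ln (x + 1/2) - 1)))"
    using z by (simp_all add: powr_def ln_div right_diff_distrib)
  define c where "c = ln (sqrt (2 * pi))"
  have sqrt: "sqrt (2 * pi) = exp c"
    by (simp add: c_def)
  have "burnside_remainder x = c + (x + 1/2) * (ln (x + 1/2) - 1) - ln_Gamma (x + 1)"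
    by (simp add: burnside_remainder_def c_def)
  then have "sqrt (2 * pi) / Gamma (x + 1) * ((x + 1/2) / exp 1) powr (x + 1/2)
      = exp (burnside_remainder x)"
    "Gamma (x + 1) / sqrt (2 * pi) * (exp 1 / (x + 1/2)) powr (x + 1/2)
      = exp (- burnside_remainder x)"
    unfolding powr sqrt Gamma_real_pos_exp[OF x] by (simp_all add: mult_exp_exp flip: exp_diff)
  then show "sqrt (2 * pi) / Gamma (x + 1) * ((x + 1/2) / exp 1) powr (x + 1/2) = exp (laplace kernel x)"
    "Gamma (x + 1) / sqrt (2 * pi) * (exp 1 / (x + 1/2)) powr (x + 1/2) = exp (- laplace kernel x)"
    unfolding burnside_remainder_laplace[OF assms] .
qed

lemma laplace_kernel_derivs:
  assumes "- 1/2 < x"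
  shows "laplace kernel' x = x * laplace kernel x - 1/24"
    and "laplace kernel'' x = x^2 * laplace kernel x - x / 24 + 1/48"
    and "laplace kernel''' x = x^3 * laplace kernel x - x^2 / 24 + x / 48 - 23/2880"
  using assms
  by (simp_all add: laplace_kernel' laplace_kernel'' laplace_kernel''' algebra_simps power2_eq_square power3_eq_cube)

text \<open>
  Every one of the eight functions is of this form; the coefficients \<open>c0\<close> to \<open>c3\<close> come from
  expanding the polynomial factor of the exponent in powers of \<open>x\<close>, and \<open>C\<close> collects the
  constant boundary terms.
\<close>

lemma log_completely_monotonic_on_kernel_combination:
  assumes a: "- 1/2 \<le> a"
    and w: "\<And>t. 0 < t \<Longrightarrow> 0 \<le> c0 * kernel t + (c1 * kernel' t + (c2 * kernel'' t + c3 * kernel''' t))"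
    and f: "\<And>x. a < x \<Longrightarrow> f x = exp (C + (c0 * laplace kernel x + (c1 * laplace kernel' x
                + (c2 * laplace kernel'' x + c3 * laplace kernel''' x))))"
  shows "log_completely_monotonic_on f {a<..}"
proof (rule log_completely_monotonic_on_exp_laplace)
  let ?w = "\<lambda>t. c0 * kernel t + (c1 * kernel' t + (c2 * kernel'' t + c3 * kernel''' t))"
  have int: "laplace_integrable a (\<lambda>t. c0 * kernel t)" "laplace_integrable a (\<lambda>t. c1 * kernel' t)"
      "laplace_integrable a (\<lambda>t. c2 * kernel'' t)" "laplace_integrable a (\<lambda>t. c3 * kernel''' t)"
    by (intro laplace_integrable_cmult laplace_integrable_mono[OF _ a] laplace_integrable_kernel)+
  then show "laplace_integrable a ?w"
    by (intro laplace_integrable_add)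
  fix x assume x: "a < x"
  have "laplace ?w x = c0 * laplace kernel x + (c1 * laplace kernel' x + (c2 * laplace kernel'' x + c3 * laplace kernel''' x))"
    using int x by (simp only: laplace_add laplace_integrable_add laplace_cmult)
  then show "f x = exp (C + laplace ?w x)"
    using f[OF x] by simp
qed (rule w)

lemma exp_powr: "exp (u :: real) powr y = exp (y * u)"
  by (simp add: powr_def)

theorem theorem1p2:
  "log_completely_monotonic_on
     (\<lambda>x. (Gamma (x + 1) / sqrt (2 * pi) * (exp 1 / (x + 1/2)) powr (x + 1/2)) powr x)
     {0<..} \<and>
   log_completely_monotonic_on
     (\<lambda>x. (sqrt (2 * pi) / Gamma (x + 1) * ((x + 1/2) / exp 1) powr (x + 1/2)) powr (8 * x^2)
            * exp (- x / 3))
     {0<..} \<and>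
   log_completely_monotonic_on
     (\<lambda>x. (Gamma (x + 1) / sqrt (2 * pi) * (exp 1 / (x + 1/2)) powr (x + 1/2)) powr (16 * x^3)
            * exp (x * (2 * x - 1) / 3))
     {0<..} \<and>
   log_completely_monotonic_on
     (\<lambda>x. sqrt (2 * pi) / Gamma (x + 1) * ((x + 1/2) / exp 1) powr (x + 1/2))
     {-1/2<..} \<and>
   log_completely_monotonic_on
     (\<lambda>x. (Gamma (x + 1) / sqrt (2 * pi) * (exp 1 / (x + 1/2)) powr (x + 1/2)) powr (2 * x + 1))
     {-1/2<..} \<and>
   log_completely_monotonic_on
     (\<lambda>x. (sqrt (2 * pi) / Gamma (x + 1) * ((x + 1/2) / exp 1) powr (x + 1/2)) powr (x + 1))
     {-1/2<..} \<and>
   log_completely_monotonic_on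
     (\<lambda>x. (sqrt (2 * pi) / Gamma (x + 1) * ((x + 1/2) / exp 1) powr (x + 1/2)) powr ((x + 1)^2)
            * exp (- x / 24))
     {-1/2<..} \<and>
   log_completely_monotonic_on
     (\<lambda>x. (sqrt (2 * pi) / Gamma (x + 1) * ((x + 1/2) / exp 1) powr (x + 1/2)) powr ((x + 1)^3)
            * exp (- x * (2 * x + 5) / 48))
     {-1/2<..}"
    (is "?c1 \<and> ?c2 \<and> ?c3 \<and> ?c4 \<and> ?c5 \<and> ?c6 \<and> ?c7 \<and> ?c8")
proof (intro conjI)
  note reduce = burnside_quotient exp_powr mult_exp_exp laplace_kernel_derivs
  have pos: "- 1/2 < x" if "0 < x" for x :: real
    using that by simp
  show ?c1
  proof (rule log_completely_monotonic_on_kernel_combination[where C = "- 1/24"])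
    show "0 \<le> 0 * kernel t + (- 1 * kernel' t + (0 * kernel'' t + 0 * kernel''' t))" if "0 < t" for t
      using kernel'_nonpos[OF that] by simp
  qed (simp, simp only: reduce pos, simp add: algebra_simps)
  show ?c2
  proof (rule log_completely_monotonic_on_kernel_combination[where C = "- 1/6"])
    show "0 \<le> 0 * kernel t + (0 * kernel' t + (8 * kernel'' t + 0 * kernel''' t))" if "0 < t" for t
      using kernel''_nonneg[OF that] by simp
  qed (simp, simp only: reduce pos, simp add: algebra_simps)
  show ?c3
  proof (rule log_completely_monotonic_on_kernel_combination[where C = "- 23/180"])
    show "0 \<le> 0 * kernel t + (0 * kernel' t + (0 * kernel'' t + - 16 * kernel''' t))" if "0 < t" for t
      using kernel'''_nonpos[OF that] by simp
  qed (simp, simp only: reduce pos, simp add: field_simps power2_eq_square)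
  show ?c4
  proof (rule log_completely_monotonic_on_kernel_combination[where C = "0"])
    show "0 \<le> 1 * kernel t + (0 * kernel' t + (0 * kernel'' t + 0 * kernel''' t))" if "0 < t" for t
      using kernel_nonneg[OF that] by simp
  qed (simp, simp only: reduce, simp)
  show ?c5
  proof (rule log_completely_monotonic_on_kernel_combination[where C = "- 1/12"])
    show "0 \<le> - 1 * kernel t + (- 2 * kernel' t + (0 * kernel'' t + 0 * kernel''' t))" if "0 < t" for t
      using two_kernel'_plus_kernel_nonpos[OF that] by simp
  qed (simp, simp only: reduce, simp add: algebra_simps)
  show ?c6
  proof (rule log_completely_monotonic_on_kernel_combination[where C = "1/24"])
    show "0 \<le> 1 * kernel t + (1 * kernel' t + (0 * kernel'' t + 0 * kernel''' t))" if "0 < t" for t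
      using kernel_binomial_sum1_nonneg[OF that] by simp
  qed (simp, simp only: reduce, simp add: algebra_simps)
  show ?c7
  proof (rule log_completely_monotonic_on_kernel_combination[where C = "1/16"])
    show "0 \<le> 1 * kernel t + (2 * kernel' t + (1 * kernel'' t + 0 * kernel''' t))" if "0 < t" for t
      using kernel_binomial_sum2_nonneg[OF that] by simp
  qed (simp, simp only: reduce, simp add: algebra_simps power2_eq_square)
  show ?c8
  proof (rule log_completely_monotonic_on_kernel_combination[where C = "23/2880 + 1/16"])
    show "0 \<le> 1 * kernel t + (3 * kernel' t + (3 * kernel'' t + 1 * kernel''' t))" if "0 < t" for t
      using kernel_binomial_sum3_nonneg[OF that] by simp
  qed (simp, simp only: reduce, simp add: field_simps power2_eq_square power3_eq_cube)
qed

end
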